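(* (i) For every $n>3$, every ortholattice satisfying the $n$OA law satisfies the $(n-1)$OA law. (ii) For each $n\in\{3,4,5\}$, there is an ortholattice (indeed a finite orthomodular lattice) satisfying the $n$OA law but not the $(n+1)$OA law.
   Context: An ortholattice (OL) is a bounded lattice with an operation $'$ satisfying $a''=a$, $a\le b\Rightarrow b'\le a'$, $a\cap a'=0$ and $a\cup a'=1$. An orthomodular lattice is an OL in which $a\le b$ implies $b=a\cup(a'\cap b)$. Write $a\to b=a'\cup(a\cap b)$. The operation $\overset{(n)}{\equiv}$ is defined by $$a_1\overset{(3)}{\equiv}a_2=((a_1\to a_3)\cap(a_2\to a_3))\cup((a_1'\to a_3)\cap(a_2'\to a_3)),$$ $$a_1\overset{(n)}{\equiv}a_2=(a_1\overset{(n-1)}{\equiv}a_2)\cup((a_1\overset{(n-1)}{\equiv}a_n)\cap(a_2\overset{(n-1)}{\equiv}a_n))\quad (n\ge4).$$ In each $(n-1)$-level subexpression only the two displayed variables are substituted; $a_3$ stays fixed. The $n$OA law is $(a_1\to a_3)\cap(a_1\overset{(n)}{\equiv}a_2)\le a_2\to a_3$, required for all $a_1,\dots,a_n$. *)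

theory Defs
  imports Main
begin

record 'a ol =
  carrier :: "'a set"
  le      :: "'a \<Rightarrow> 'a \<Rightarrow> bool"
  meet    :: "'a \<Rightarrow> 'a \<Rightarrow> 'a"
  join    :: "'a \<Rightarrow> 'a \<Rightarrow> 'a"
  compl   :: "'a \<Rightarrow> 'a"
  bot     :: 'a
  top     :: 'a

definition ortholattice :: "'a ol \<Rightarrow> bool" where
  "ortholattice L \<longleftrightarrow>
     (\<forall>x\<in>carrier L. le L x x)
   \<and> (\<forall>x\<in>carrier L. \<forall>y\<in>carrier L. le L x y \<and> le L y x \<longrightarrow> x = y)
   \<and> (\<forall>x\<in>carrier L. \<forall>y\<in>carrier L. \<forall>z\<in>carrier L. le L x y \<and> le L y z \<longrightarrow> le L x z)
   \<and> (\<forall>x\<in>carrier L. \<forall>y\<in>carrier L. meet L x y \<in> carrier L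
        \<and> le L (meet L x y) x \<and> le L (meet L x y) y
        \<and> (\<forall>z\<in>carrier L. le L z x \<and> le L z y \<longrightarrow> le L z (meet L x y)))
   \<and> (\<forall>x\<in>carrier L. \<forall>y\<in>carrier L. join L x y \<in> carrier L
        \<and> le L x (join L x y) \<and> le L y (join L x y)
        \<and> (\<forall>z\<in>carrier L. le L x z \<and> le L y z \<longrightarrow> le L (join L x y) z))
   \<and> bot L \<in> carrier L \<and> top L \<in> carrier L
   \<and> (\<forall>x\<in>carrier L. le L (bot L) x \<and> le L x (top L))
   \<and> (\<forall>x\<in>carrier L. compl L x \<in> carrier L)
   \<and> (\<forall>x\<in>carrier L. compl L (compl L x) = x)
   \<and> (\<forall>x\<in>carrier L. \<forall>y\<in>carrier L. le L x y \<longrightarrow> le L (compl L y) (compl L x))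
   \<and> (\<forall>x\<in>carrier L. meet L x (compl L x) = bot L)
   \<and> (\<forall>x\<in>carrier L. join L x (compl L x) = top L)"

definition orthomodular :: "'a ol \<Rightarrow> bool" where
  "orthomodular L \<longleftrightarrow> ortholattice L \<and>
     (\<forall>x\<in>carrier L. \<forall>y\<in>carrier L. le L x y \<longrightarrow> y = join L x (meet L (compl L x) y))"

definition oimp :: "'a ol \<Rightarrow> 'a \<Rightarrow> 'a \<Rightarrow> 'a" where
  "oimp L x y = join L (compl L x) (meet L x y)"

text \<open>The operation x \<equiv>(n) y with respect to the variables a 3, a 4, ..., a n
  (indices as in the paper, a 1, a 2, ... ; a 0 unused).  Level 3 is the base;
  for n \<ge> 4 the recursion of the paper is used.  Levels below 3 are given the
  level-3 value (never used).\<close>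
primrec oeqv :: "'a ol \<Rightarrow> (nat \<Rightarrow> 'a) \<Rightarrow> nat \<Rightarrow> 'a \<Rightarrow> 'a \<Rightarrow> 'a" where
  "oeqv L a 0 x y =
     join L (meet L (oimp L x (a 3)) (oimp L y (a 3)))
            (meet L (oimp L (compl L x) (a 3)) (oimp L (compl L y) (a 3)))"
| "oeqv L a (Suc n) x y =
     (if Suc n \<le> 3 then
        join L (meet L (oimp L x (a 3)) (oimp L y (a 3)))
               (meet L (oimp L (compl L x) (a 3)) (oimp L (compl L y) (a 3)))
      else join L (oeqv L a n x y)
                  (meet L (oeqv L a n x (a (Suc n))) (oeqv L a n y (a (Suc n)))))"

definition nOA :: "'a ol \<Rightarrow> nat \<Rightarrow> bool" where
  "nOA L n \<longleftrightarrow> (\<forall>a :: nat \<Rightarrow> 'a. (\<forall>i. 1 \<le> i \<and> i \<le> n \<longrightarrow> a i \<in> carrier L) \<longrightarrow>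
      le L (meet L (oimp L (a 1) (a 3)) (oeqv L a n (a 1) (a 2))) (oimp L (a 2) (a 3)))"

end

theory Submission
  imports Defs
begin

text \<open>Each level of the equivalence only adds joinands to the previous one, so (i) is monotonicity.

  For (ii), fix \<open>c = a\<^sub>3\<close> and put \<open>p x = x \<rightarrow> c\<close>, \<open>q x = x' \<rightarrow> c\<close>; the level-3 equivalence and the law
  only depend on these pairs. Suppose \<open>U x y\<close> dominates the level-3 equivalence,
  \<open>U x z \<inter> U y z \<le> U x y\<close>, and \<open>p x \<inter> U x y \<le> p y\<close>. Then \<open>U\<close> dominates all levels, so the law holds at
  \<open>c\<close> for every \<open>n\<close>. For \<open>n = 4, 5\<close>, in a suitable finite orthomodular lattice of height 3 such a \<open>U\<close> exists for all
  \<open>c\<close> but one. At the exceptional \<open>c\<close> there are \<open>n\<close> pairs \<open>x, x'\<close> all of which occur in any failure of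
  the law, and \<open>U\<close> exists as soon as one of them is excluded; as only \<open>n - 1\<close> variables other than
  \<open>a\<^sub>3\<close> are available, the \<open>n\<close>OA law holds, and with one more variable it fails. For
  \<open>n = 3\<close> only the level-3 equivalence has to be checked.\<close>

section \<open>General ortholattices\<close>

locale ortholat =
  fixes L :: "'a ol"
  assumes ol: "ortholattice L"
begin

lemmas ol_axioms = ol[unfolded ortholattice_def]

lemma le_refl: "x \<in> carrier L \<Longrightarrow> le L x x"
  using ol_axioms[THEN conjunct1] by blast

lemma le_trans: "le L x y \<Longrightarrow> le L y z \<Longrightarrow> x \<in> carrier L \<Longrightarrow> y \<in> carrier L \<Longrightarrow> z \<in> carrier L \<Longrightarrow> le L x z"
  using ol_axioms[THEN conjunct2, THEN conjunct2, THEN conjunct1] by blast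

lemma meet_closed: "x \<in> carrier L \<Longrightarrow> y \<in> carrier L \<Longrightarrow> meet L x y \<in> carrier L"
  using ol_axioms[THEN conjunct2, THEN conjunct2, THEN conjunct2, THEN conjunct1] by simp

lemma meet_le1: "x \<in> carrier L \<Longrightarrow> y \<in> carrier L \<Longrightarrow> le L (meet L x y) x"
  using ol_axioms[THEN conjunct2, THEN conjunct2, THEN conjunct2, THEN conjunct1] by simp

lemma meet_le2: "x \<in> carrier L \<Longrightarrow> y \<in> carrier L \<Longrightarrow> le L (meet L x y) y"
  using ol_axioms[THEN conjunct2, THEN conjunct2, THEN conjunct2, THEN conjunct1] by simp

lemma meet_greatest: "le L z x \<Longrightarrow> le L z y \<Longrightarrow> x \<in> carrier L \<Longrightarrow> y \<in> carrier L \<Longrightarrow> z \<in> carrier L \<Longrightarrow> le L z (meet L x y)"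
  using ol_axioms[THEN conjunct2, THEN conjunct2, THEN conjunct2, THEN conjunct1] by blast

lemma join_closed: "x \<in> carrier L \<Longrightarrow> y \<in> carrier L \<Longrightarrow> join L x y \<in> carrier L"
  using ol_axioms[THEN conjunct2, THEN conjunct2, THEN conjunct2, THEN conjunct2, THEN conjunct1] by simp

lemma join_ge1: "x \<in> carrier L \<Longrightarrow> y \<in> carrier L \<Longrightarrow> le L x (join L x y)"
  using ol_axioms[THEN conjunct2, THEN conjunct2, THEN conjunct2, THEN conjunct2, THEN conjunct1] by simp

lemma join_least: "le L x z \<Longrightarrow> le L y z \<Longrightarrow> x \<in> carrier L \<Longrightarrow> y \<in> carrier L \<Longrightarrow> z \<in> carrier L \<Longrightarrow> le L (join L x y) z"
  using ol_axioms[THEN conjunct2, THEN conjunct2, THEN conjunct2, THEN conjunct2, THEN conjunct1] by blast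

lemma bot_closed: "bot L \<in> carrier L"
  using ol_axioms[THEN conjunct2, THEN conjunct2, THEN conjunct2, THEN conjunct2, THEN conjunct2, THEN conjunct1] by simp

lemma compl_closed: "x \<in> carrier L \<Longrightarrow> compl L x \<in> carrier L"
  using ol_axioms[THEN conjunct2, THEN conjunct2, THEN conjunct2, THEN conjunct2, THEN conjunct2, THEN conjunct2, THEN conjunct2, THEN conjunct2, THEN conjunct1] by simp

lemmas closed = meet_closed join_closed compl_closed

lemma meet_mono:
  assumes "le L x x'" "le L y y'" "x \<in> carrier L" "x' \<in> carrier L" "y \<in> carrier L" "y' \<in> carrier L"
  shows "le L (meet L x y) (meet L x' y')"
proof -
  have m: "meet L x y \<in> carrier L" using assms(3,5) by (rule meet_closed)
  have "le L (meet L x y) x'"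
    by (rule le_trans[OF meet_le1 assms(1)]) (fact assms m)+
  moreover have "le L (meet L x y) y'"
    by (rule le_trans[OF meet_le2 assms(2)]) (fact assms m)+
  ultimately show ?thesis
    by (rule meet_greatest) (fact assms m)+
qed

lemma oimp_closed: "x \<in> carrier L \<Longrightarrow> y \<in> carrier L \<Longrightarrow> oimp L x y \<in> carrier L"
  by (simp add: oimp_def closed)

lemma oeqv_closed:
  assumes "a 3 \<in> carrier L" "\<And>i. 4 \<le> i \<Longrightarrow> i \<le> n \<Longrightarrow> a i \<in> carrier L"
    "x \<in> carrier L" "y \<in> carrier L"
  shows "oeqv L a n x y \<in> carrier L"
  using assms
proof (induction n arbitrary: x y)
  case 0
  then show ?case by (auto intro!: closed oimp_closed)
next
  case (Suc n)
  have IH: "oeqv L a n u v \<in> carrier L" if "u \<in> carrier L" "v \<in> carrier L" for u v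
    by (rule Suc.IH) (use Suc.prems that in auto)
  show ?case
    using Suc.prems by (auto intro!: closed oimp_closed IH)
qed

lemma oeqv_mono_level:
  assumes "\<forall>i. 3 \<le> i \<and> i \<le> Suc n \<longrightarrow> a i \<in> carrier L" "3 \<le> n" "x \<in> carrier L" "y \<in> carrier L"
  shows "le L (oeqv L a n x y) (oeqv L a (Suc n) x y)"
proof -
  have E: "oeqv L a n u v \<in> carrier L" if "u \<in> carrier L" "v \<in> carrier L" for u v
    using assms that by (intro oeqv_closed) auto
  have "a (Suc n) \<in> carrier L" using assms by simp
  then show ?thesis using assms by (auto intro!: join_ge1 closed E)
qed

lemma nOA_pred:
  assumes n: "3 < n" and OA: "nOA L n"
  shows "nOA L (n - 1)"
  unfolding nOA_def
proof (intro allI impI)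
  fix a :: "nat \<Rightarrow> 'a"
  assume a: "\<forall>i. 1 \<le> i \<and> i \<le> n - 1 \<longrightarrow> a i \<in> carrier L"
  \<comment> \<open>The hypotheses say nothing about \<open>a n\<close>, so any element of the
    carrier may be put there; levels below \<open>n\<close> do not see the change.\<close>
  define b where "b = a(n := bot L)"
  have b: "b i \<in> carrier L" if "1 \<le> i" "i \<le> n" for i
    using a that bot_closed unfolding b_def by auto
  have low: "b i = a i" if "i < n" for i using that by (simp add: b_def)
  have cong: "oeqv L b m x y = oeqv L a m x y" if "m < n" for m x y
    using that n by (induction m arbitrary: x y) (auto simp: low)
  have cl: "oeqv L b n (b 1) (b 2) \<in> carrier L" "oeqv L b (n - 1) (b 1) (b 2) \<in> carrier L"
    using b n by (auto intro!: oeqv_closed)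
  have imps: "oimp L (b 1) (b 3) \<in> carrier L" "oimp L (b 2) (b 3) \<in> carrier L"
    using b n by (auto intro!: oimp_closed)
  have "le L (oeqv L b (n - 1) (b 1) (b 2)) (oeqv L b n (b 1) (b 2))"
    using oeqv_mono_level[of "n - 1" b "b 1" "b 2"] b n by simp
  then have "le L (meet L (oimp L (b 1) (b 3)) (oeqv L b (n - 1) (b 1) (b 2)))
      (meet L (oimp L (b 1) (b 3)) (oeqv L b n (b 1) (b 2)))"
    by (intro meet_mono le_refl imps cl)
  moreover have "le L (meet L (oimp L (b 1) (b 3)) (oeqv L b n (b 1) (b 2))) (oimp L (b 2) (b 3))"
    using OA b unfolding nOA_def by blast
  ultimately have "le L (meet L (oimp L (b 1) (b 3)) (oeqv L b (n - 1) (b 1) (b 2))) (oimp L (b 2) (b 3))"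
    by (rule le_trans) (simp_all del: One_nat_def add: closed imps cl)
  then show "le L (meet L (oimp L (a 1) (a 3)) (oeqv L a (n - 1) (a 1) (a 2))) (oimp L (a 2) (a 3))"
    using n by (simp add: cong low)
qed

section \<open>Transitive upper bounds for all levels at once\<close>

text \<open>If \<open>U\<close> bounds the level-3 operation and is transitive in the sense of \<open>trans\<close>,
  then it bounds every level, because each level only adds terms that transitivity absorbs.\<close>

lemma oeqv_bound:
  assumes X: "X \<subseteq> carrier L" and c: "a 3 \<in> carrier L"
    and U: "\<And>x y. x \<in> X \<Longrightarrow> y \<in> X \<Longrightarrow> U x y \<in> carrier L"
    and base: "\<And>x y. x \<in> X \<Longrightarrow> y \<in> X \<Longrightarrow> le L (oeqv L a 3 x y) (U x y)"
    and trans: "\<And>x y z. x \<in> X \<Longrightarrow> y \<in> X \<Longrightarrow> z \<in> X \<Longrightarrow> le L (meet L (U x z) (U y z)) (U x y)"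
    and n: "3 \<le> n" and aX: "\<And>i. 4 \<le> i \<Longrightarrow> i \<le> n \<Longrightarrow> a i \<in> X"
    and xy: "x \<in> X" "y \<in> X"
  shows "le L (oeqv L a n x y) (U x y)"
  using n aX xy
proof (induction n arbitrary: x y rule: dec_induct)
  case base
  show ?case by (rule assms(4)) (fact base)+
next
  case (step m)
  have z: "a (Suc m) \<in> X" using step.prems(1)[of "Suc m"] \<open>3 \<le> m\<close> by simp
  have "a i \<in> carrier L" if "3 \<le> i" "i \<le> m" for i
    using that step.prems(1)[of i] X c by (cases "i = 3") auto
  then have E: "oeqv L a m u v \<in> carrier L" if "u \<in> X" "v \<in> X" for u v
    using that X \<open>3 \<le> m\<close> by (intro oeqv_closed) auto
  have IH: "le L (oeqv L a m u v) (U u v)" if "u \<in> X" "v \<in> X" for u v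
    by (rule step.IH) (use step.prems that in auto)
  let ?z = "a (Suc m)"
  have "le L (meet L (oeqv L a m x ?z) (oeqv L a m y ?z)) (meet L (U x ?z) (U y ?z))"
    by (intro meet_mono IH E U z step.prems)
  then have "le L (meet L (oeqv L a m x ?z) (oeqv L a m y ?z)) (U x y)"
    by (rule le_trans) (simp_all add: trans closed E U z step.prems)
  then have "le L (join L (oeqv L a m x y) (meet L (oeqv L a m x ?z) (oeqv L a m y ?z))) (U x y)"
    by (intro join_least IH closed E U z step.prems)
  then show ?case using \<open>3 \<le> m\<close> by simp
qed

text \<open>\<open>X\<close> and \<open>U\<close> are chosen after the variables. \<open>X\<close>
  only has to contain the variables other than \<open>a 3\<close>, so a value of \<open>a 3\<close>
  for which no \<open>U\<close> exists on the whole carrier can still be handled.\<close>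

lemma nOA_if_bound:
  assumes n: "3 \<le> n"
    and bound: "\<And>a. (\<And>i. 1 \<le> i \<Longrightarrow> i \<le> n \<Longrightarrow> a i \<in> carrier L) \<Longrightarrow>
      \<exists>X U. X \<subseteq> carrier L \<and> (\<forall>i\<in>{1..n} - {3}. a i \<in> X)
        \<and> (\<forall>x\<in>X. \<forall>y\<in>X. U x y \<in> carrier L \<and> le L (oeqv L a 3 x y) (U x y)
             \<and> le L (meet L (oimp L x (a 3)) (U x y)) (oimp L y (a 3)))
        \<and> (\<forall>x\<in>X. \<forall>y\<in>X. \<forall>z\<in>X. le L (meet L (U x z) (U y z)) (U x y))"
  shows "nOA L n"
  unfolding nOA_def
proof (intro allI impI)
  fix a :: "nat \<Rightarrow> 'a"
  assume a: "\<forall>i. 1 \<le> i \<and> i \<le> n \<longrightarrow> a i \<in> carrier L"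
  then obtain X U where X: "X \<subseteq> carrier L" and aX: "\<forall>i\<in>{1..n} - {3}. a i \<in> X"
    and U: "\<forall>x\<in>X. \<forall>y\<in>X. U x y \<in> carrier L \<and> le L (oeqv L a 3 x y) (U x y)
             \<and> le L (meet L (oimp L x (a 3)) (U x y)) (oimp L y (a 3))"
    and tr: "\<forall>x\<in>X. \<forall>y\<in>X. \<forall>z\<in>X. le L (meet L (U x z) (U y z)) (U x y)"
    using bound[of a] by metis
  have c: "a 3 \<in> carrier L" using a n by simp
  have 12: "a 1 \<in> X" "a 2 \<in> X" using aX n by auto
  have "le L (oeqv L a n (a 1) (a 2)) (U (a 1) (a 2))"
    by (rule oeqv_bound[where X = X]) (use X U tr aX n c 12 in auto)
  moreover have E: "oeqv L a n (a 1) (a 2) \<in> carrier L"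
    using a n by (intro oeqv_closed) auto
  moreover have imps: "oimp L (a 1) (a 3) \<in> carrier L" "oimp L (a 2) (a 3) \<in> carrier L"
    using 12 X c by (auto intro: oimp_closed)
  moreover have U12: "U (a 1) (a 2) \<in> carrier L"
    using U 12 by blast
  ultimately have "le L (meet L (oimp L (a 1) (a 3)) (oeqv L a n (a 1) (a 2)))
      (meet L (oimp L (a 1) (a 3)) (U (a 1) (a 2)))"
    by (intro meet_mono le_refl)
  moreover have "le L (meet L (oimp L (a 1) (a 3)) (U (a 1) (a 2))) (oimp L (a 2) (a 3))"
    using U 12 by blast
  ultimately show "le L (meet L (oimp L (a 1) (a 3)) (oeqv L a n (a 1) (a 2))) (oimp L (a 2) (a 3))"
    by (rule le_trans) (simp_all del: One_nat_def add: closed imps E U12)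
qed

end

section \<open>Transport of an ortholattice along an injection\<close>

definition map_ol :: "('a \<Rightarrow> 'b) \<Rightarrow> 'a ol \<Rightarrow> 'b ol" where
  "map_ol f L =
     \<lparr>carrier = f ` carrier L,
      le = \<lambda>x y. le L (inv f x) (inv f y),
      meet = \<lambda>x y. f (meet L (inv f x) (inv f y)),
      join = \<lambda>x y. f (join L (inv f x) (inv f y)),
      compl = \<lambda>x. f (compl L (inv f x)),
      bot = f (bot L),
      top = f (top L)\<rparr>"

context
  fixes f :: "'a \<Rightarrow> 'b" and L :: "'a ol"
  assumes f: "inj f"
begin

lemma map_ol_simps:
  "carrier (map_ol f L) = f ` carrier L"
  "le (map_ol f L) (f x) (f y) \<longleftrightarrow> le L x y"
  "meet (map_ol f L) (f x) (f y) = f (meet L x y)"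
  "join (map_ol f L) (f x) (f y) = f (join L x y)"
  "compl (map_ol f L) (f x) = f (compl L x)"
  "bot (map_ol f L) = f (bot L)"
  "top (map_ol f L) = f (top L)"
  by (simp_all add: map_ol_def f)

lemma ortholattice_map_ol:
  assumes "ortholattice L"
  shows "ortholattice (map_ol f L)"
  \<comment> \<open>Quantifiers over the image become quantifiers over \<open>carrier L\<close>;
    with \<open>f\<close> cancelled, the goal is literally the list of axioms of
    \<open>L\<close>.\<close>
  unfolding ortholattice_def map_ol_simps ball_simps(9)
  by (simp only: map_ol_simps inj_image_mem_iff[OF f] inj_eq[OF f])
    (rule assms[unfolded ortholattice_def])

lemma orthomodular_map_ol:
  assumes "orthomodular L"
  shows "orthomodular (map_ol f L)"
  unfolding orthomodular_def map_ol_simps ball_simps(9)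
  by (simp only: map_ol_simps inj_eq[OF f])
    (use assms ortholattice_map_ol in \<open>simp add: orthomodular_def\<close>)

lemma oimp_map_ol: "oimp (map_ol f L) (f x) (f y) = f (oimp L x y)"
  by (simp add: oimp_def map_ol_simps)

lemma oeqv_map_ol: "oeqv (map_ol f L) (f \<circ> a) n (f x) (f y) = f (oeqv L a n x y)"
  by (induction n arbitrary: x y) (simp_all only: oeqv.simps o_apply oimp_map_ol map_ol_simps if_distrib[of f])

text \<open>Needed because a pulled-back assignment \<open>f \<circ> inv f \<circ> b\<close> agrees
  with \<open>b\<close> only at indices where \<open>b\<close> takes values in the range of
  \<open>f\<close>.\<close>

lemma oeqv_cong:
  fixes K :: "'c ol"
  assumes "\<And>i. 3 \<le> i \<Longrightarrow> i \<le> n \<Longrightarrow> a i = b i" "3 \<le> n"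
  shows "oeqv K a n x y = oeqv K b n x y"
  using assms(2,1)
proof (induction n arbitrary: x y rule: dec_induct)
  case base
  then show ?case by (simp add: numeral_3_eq_3)
qed simp

lemma nOA_map_ol:
  assumes n: "3 \<le> n"
  shows "nOA (map_ol f L) n \<longleftrightarrow> nOA L n"
proof
  have le: "le (map_ol f L) (meet (map_ol f L) (oimp (map_ol f L) (f (a 1)) (f (a 3)))
      (oeqv (map_ol f L) (f \<circ> a) n (f (a 1)) (f (a 2)))) (oimp (map_ol f L) (f (a 2)) (f (a 3)))
    \<longleftrightarrow> le L (meet L (oimp L (a 1) (a 3)) (oeqv L a n (a 1) (a 2))) (oimp L (a 2) (a 3))" for a
    by (simp only: oeqv_map_ol oimp_map_ol map_ol_simps)
  {
    assume OA: "nOA (map_ol f L) n"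
    show "nOA L n"
      unfolding nOA_def
    proof (intro allI impI)
      fix a :: "nat \<Rightarrow> 'a"
      assume "\<forall>i. 1 \<le> i \<and> i \<le> n \<longrightarrow> a i \<in> carrier L"
      then have "\<forall>i. 1 \<le> i \<and> i \<le> n \<longrightarrow> (f \<circ> a) i \<in> carrier (map_ol f L)"
        by (simp add: map_ol_def)
      with OA have "le (map_ol f L) (meet (map_ol f L) (oimp (map_ol f L) ((f \<circ> a) 1) ((f \<circ> a) 3))
          (oeqv (map_ol f L) (f \<circ> a) n ((f \<circ> a) 1) ((f \<circ> a) 2)))
          (oimp (map_ol f L) ((f \<circ> a) 2) ((f \<circ> a) 3))"
        unfolding nOA_def by blast
      then show "le L (meet L (oimp L (a 1) (a 3)) (oeqv L a n (a 1) (a 2))) (oimp L (a 2) (a 3))"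
        unfolding o_apply le .
    qed
  }
  {
    assume OA: "nOA L n"
    show "nOA (map_ol f L) n"
      unfolding nOA_def
    proof (intro allI impI)
      fix b :: "nat \<Rightarrow> 'b"
      assume b: "\<forall>i. 1 \<le> i \<and> i \<le> n \<longrightarrow> b i \<in> carrier (map_ol f L)"
      define a where "a = inv f \<circ> b"
      have fa: "f (a i) = b i" if "1 \<le> i" "i \<le> n" for i
        using b that f by (auto simp: a_def map_ol_def)
      have "a i \<in> carrier L" if "1 \<le> i" "i \<le> n" for i
        using b that f by (auto simp: a_def map_ol_def)
      with OA have "le L (meet L (oimp L (a 1) (a 3)) (oeqv L a n (a 1) (a 2))) (oimp L (a 2) (a 3))"
        unfolding nOA_def by blast
      then have "le (map_ol f L) (meet (map_ol f L) (oimp (map_ol f L) (f (a 1)) (f (a 3)))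
          (oeqv (map_ol f L) (f \<circ> a) n (f (a 1)) (f (a 2)))) (oimp (map_ol f L) (f (a 2)) (f (a 3)))"
        unfolding le .
      moreover have "oeqv (map_ol f L) (f \<circ> a) n x y = oeqv (map_ol f L) b n x y" for x y
        using n by (intro oeqv_cong) (auto simp: fa)
      ultimately show "le (map_ol f L) (meet (map_ol f L) (oimp (map_ol f L) (b 1) (b 3))
          (oeqv (map_ol f L) b n (b 1) (b 2))) (oimp (map_ol f L) (b 2) (b 3))"
        using n by (simp add: fa)
    qed
  }
qed

end

lemma finite_ol_in_nat:
  fixes L :: "'a ol"
  assumes "finite (UNIV :: 'a set)" "orthomodular L" "3 \<le> n" "nOA L n" "\<not> nOA L (n + 1)"
  shows "\<exists>K :: nat ol. ortholattice K \<and> orthomodular K \<and> finite (carrier K)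
    \<and> nOA K n \<and> \<not> nOA K (n + 1)"
proof -
  obtain f :: "'a \<Rightarrow> nat" where f: "inj f"
    using finite_imp_inj_to_nat_seg[OF assms(1)] by metis
  have "orthomodular (map_ol f L)"
    using orthomodular_map_ol[OF f] assms(2) .
  moreover from this have "ortholattice (map_ol f L)"
    by (simp add: orthomodular_def)
  moreover have "finite (carrier (map_ol f L))"
    using finite_subset[OF subset_UNIV assms(1)] by (simp add: map_ol_def)
  moreover have "nOA (map_ol f L) n" "\<not> nOA (map_ol f L) (n + 1)"
    using assms nOA_map_ol[OF f] by simp_all
  ultimately show ?thesis by blast
qed

section \<open>Orthomodular lattices of height 3\<close>

text \<open>The orthomodular lattices used here have height 3: besides the bounds there are atoms and their
  complements. Such a lattice is given by the graph of orthogonal atoms, tabulated as follows.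
  \<open>N g\<close>: orthogonal atoms, \<open>g\<close> is the third atom of their block; \<open>D g\<close>: non-orthogonal atoms with
  common neighbour \<open>g\<close>; \<open>S\<close>: the same atom; \<open>F\<close>: none of these.\<close>

datatype 'a rl = S | F | N 'a | D 'a

datatype 'a el = Bot | Top | At 'a | Co 'a

primrec isS :: "'a rl \<Rightarrow> bool" where
  "isS S = True" | "isS F = False" | "isS (N g) = False" | "isS (D g) = False"

primrec isN :: "'a rl \<Rightarrow> bool" where
  "isN S = False" | "isN F = False" | "isN (N g) = True" | "isN (D g) = False"

text \<open>The atoms below \<open>Co a\<close> are the neighbours of \<open>a\<close>, so two
  different complements meet in the common neighbour of their atoms if there is one, and in
  \<open>Bot\<close> otherwise.\<close>

primrec co_meet :: "'a \<Rightarrow> 'a rl \<Rightarrow> 'a el" where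
  "co_meet a S = Co a" | "co_meet a F = Bot" | "co_meet a (N g) = At g" | "co_meet a (D g) = At g"

primrec neg :: "'a el \<Rightarrow> 'a el" where
  "neg Bot = Top" | "neg Top = Bot" | "neg (At a) = Co a" | "neg (Co a) = At a"

fun lte :: "('a \<Rightarrow> 'a \<Rightarrow> 'a rl) \<Rightarrow> 'a el \<Rightarrow> 'a el \<Rightarrow> bool" where
  "lte r Bot y = True"
| "lte r Top Bot = False" | "lte r Top Top = True" | "lte r Top (At b) = False" | "lte r Top (Co b) = False"
| "lte r (At a) Bot = False" | "lte r (At a) Top = True"
| "lte r (At a) (At b) = isS (r a b)" | "lte r (At a) (Co b) = isN (r a b)"
| "lte r (Co a) Bot = False" | "lte r (Co a) Top = True"
| "lte r (Co a) (At b) = False" | "lte r (Co a) (Co b) = isS (r a b)"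

fun inf_el :: "('a \<Rightarrow> 'a \<Rightarrow> 'a rl) \<Rightarrow> 'a el \<Rightarrow> 'a el \<Rightarrow> 'a el" where
  "inf_el r Bot y = Bot"
| "inf_el r Top y = y"
| "inf_el r (At a) Bot = Bot" | "inf_el r (At a) Top = At a"
| "inf_el r (At a) (At b) = (if isS (r a b) then At a else Bot)"
| "inf_el r (At a) (Co b) = (if isN (r a b) then At a else Bot)"
| "inf_el r (Co a) Bot = Bot" | "inf_el r (Co a) Top = Co a"
| "inf_el r (Co a) (At b) = (if isN (r a b) then At b else Bot)"
| "inf_el r (Co a) (Co b) = co_meet a (r a b)"

definition sup_el :: "('a \<Rightarrow> 'a \<Rightarrow> 'a rl) \<Rightarrow> 'a el \<Rightarrow> 'a el \<Rightarrow> 'a el" where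
  "sup_el r x y = neg (inf_el r (neg x) (neg y))"

definition graph_ol :: "('a \<Rightarrow> 'a \<Rightarrow> 'a rl) \<Rightarrow> 'a el ol" where
  "graph_ol r = \<lparr>carrier = UNIV, le = lte r, meet = inf_el r, join = sup_el r, compl = neg,
     bot = Bot, top = Top\<rparr>"

text \<open>Greechie's criterion for blocks of three atoms: by \<open>third\<close> and
  \<open>unique\<close> an orthogonal pair lies in exactly one block, and two distinct atoms have at
  most one common neighbour, so there are no loops of three or four blocks.\<close>

locale graph =
  fixes r :: "'a \<Rightarrow> 'a \<Rightarrow> 'a rl"
  assumes same: "isS (r a b) \<longleftrightarrow> a = b"
    and sym: "r a b = r b a"
    and third: "r a b = N g \<Longrightarrow> r a g = N b"
    and common: "r a b = D g \<Longrightarrow> isN (r a g) \<and> isN (r g b)"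
    and unique: "isN (r a g) \<Longrightarrow> isN (r g b) \<Longrightarrow> a \<noteq> b \<Longrightarrow> r a b = N g \<or> r a b = D g"
begin

lemma isN_sym: "isN (r a b) \<longleftrightarrow> isN (r b a)"
  by (simp add: sym)

lemma rel_self: "r a a = S"
  using same[of a a] by (cases "r a a") auto

lemma lte_refl: "lte r x x"
  by (cases x) (simp_all add: rel_self)

lemma lte_antisym: "lte r x y \<Longrightarrow> lte r y x \<Longrightarrow> x = y"
  by (cases x; cases y) (simp_all add: same)

lemma lte_trans: "lte r x y \<Longrightarrow> lte r y z \<Longrightarrow> lte r x z"
  by (cases x; cases y; cases z) (simp_all add: same)

lemma inf_el_comm: "inf_el r x y = inf_el r y x"
proof (cases x; cases y)
  fix a b assume xy: "x = Co a" "y = Co b"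
  then show ?thesis
    using same[of a b] by (cases "r a b") (simp_all add: sym[of b a])
next
  fix a b assume "x = At a" "y = At b"
  then show ?thesis by (auto simp: same)
qed (simp_all add: sym)

lemma inf_el_lower: "lte r (inf_el r x y) x"
proof (cases x; cases y)
  fix a b assume xy: "x = Co a" "y = Co b"
  show ?thesis
  proof (cases "r a b")
    case (N g)
    then show ?thesis using third[OF N] sym[of a g] xy by simp
  next
    case (D g)
    then show ?thesis using common[OF D] isN_sym xy by simp
  qed (use xy rel_self in auto)
qed (auto simp: rel_self sym split: if_splits)

text \<open>The case with content is \<open>Co a\<close>, \<open>Co b\<close> with an atom below
  both: it is a common neighbour, and \<open>unique\<close> says that it is the one recorded in the
  table.\<close>

lemma inf_el_greatest:
  assumes "lte r z x" "lte r z y"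
  shows "lte r z (inf_el r x y)"
proof (cases "\<exists>a b. x = Co a \<and> y = Co b")
  case True
  then obtain a b where xy: "x = Co a" "y = Co b" by blast
  show ?thesis
  proof (cases z)
    case (At e)
    then have "isN (r a e)" "isN (r e b)" using assms xy isN_sym by auto
    then show ?thesis
      using unique[of a e b] xy At rel_self by (cases "a = b") (auto simp: isN_sym)
  next
    case (Co e)
    then show ?thesis using assms xy rel_self by (simp add: same)
  qed (use assms xy in auto)
next
  case False
  then show ?thesis
    using assms by (cases x; cases y; cases z) (auto simp: same isN_sym)
qed

lemma neg_neg: "neg (neg x) = x"
  by (cases x) simp_all

lemma neg_anti: "lte r x y \<Longrightarrow> lte r (neg y) (neg x)"
  by (cases x; cases y) (auto simp: same isN_sym)

lemma neg_anti_iff: "lte r (neg x) (neg y) \<longleftrightarrow> lte r y x"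
  using neg_anti[of y x] neg_anti[of "neg x" "neg y"] by (auto simp: neg_neg)

lemma sup_el_upper: "lte r x (sup_el r x y)" "lte r y (sup_el r x y)"
  using inf_el_lower[of "neg x" "neg y"] inf_el_lower[of "neg y" "neg x"]
    neg_anti_iff[of "sup_el r x y"] by (auto simp: sup_el_def neg_neg inf_el_comm)

lemma sup_el_least: "lte r x z \<Longrightarrow> lte r y z \<Longrightarrow> lte r (sup_el r x y) z"
  using inf_el_greatest[of "neg z" "neg x" "neg y"] neg_anti_iff[of z "sup_el r x y"]
  by (simp add: sup_el_def neg_neg neg_anti)

lemma inf_el_neg: "inf_el r x (neg x) = Bot"
  by (cases x) (simp_all add: rel_self)

lemma ortholattice_graph_ol: "ortholattice (graph_ol r)"
proof -
  have "inf_el r x y = inf_el r y x" for x y by (rule inf_el_comm)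
  then have "lte r (inf_el r x y) y" for x y using inf_el_lower[of y x] by simp
  moreover have "sup_el r x (neg x) = Top" for x
    using inf_el_neg[of "neg x"] by (simp add: sup_el_def)
  moreover have "lte r x Top" for x by (cases x) simp_all
  ultimately show ?thesis
    unfolding ortholattice_def graph_ol_def
    by (auto simp: lte_refl inf_el_lower inf_el_neg sup_el_upper neg_neg
        intro: lte_antisym lte_trans inf_el_greatest sup_el_least neg_anti)
qed

text \<open>The only nontrivial comparable pair is \<open>At a\<close>, \<open>Co b\<close> with
  \<open>r a b = N g\<close>. There \<open>Co a\<close> and \<open>Co b\<close> meet in
  \<open>At g\<close>, and by \<open>third\<close> the join of \<open>At a\<close> and
  \<open>At g\<close> is \<open>Co b\<close>.\<close>

lemma orthomodular_graph_ol: "orthomodular (graph_ol r)"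
proof -
  have "y = sup_el r x (inf_el r (neg x) y)" if "lte r x y" for x y
  proof (cases x; cases y)
    fix a b assume xy: "x = At a" "y = Co b"
    with that obtain g where "r a b = N g" by (cases "r a b") auto
    then show ?thesis using xy third[of a b g] by (simp add: sup_el_def)
  qed (use that in \<open>auto simp: sup_el_def same rel_self\<close>)
  then show ?thesis
    using ortholattice_graph_ol unfolding orthomodular_def by (simp add: graph_ol_def)
qed

end

section \<open>Certificates\<close>

text \<open>\<open>oimp\<close> restated directly on a table, without the record, as a form to
  compute with.\<close>

definition imp :: "('a \<Rightarrow> 'a \<Rightarrow> 'a rl) \<Rightarrow> 'a el \<Rightarrow> 'a el \<Rightarrow> 'a el" where
  "imp r x c = sup_el r (neg x) (inf_el r x c)"

type_synonym 'a pair = "'a el \<times> 'a el"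

definition pq :: "('a \<Rightarrow> 'a \<Rightarrow> 'a rl) \<Rightarrow> 'a el \<Rightarrow> 'a el \<Rightarrow> 'a pair" where
  "pq r c x = (imp r x c, imp r (neg x) c)"

fun eqv3 :: "('a \<Rightarrow> 'a \<Rightarrow> 'a rl) \<Rightarrow> 'a pair \<Rightarrow> 'a pair \<Rightarrow> 'a el" where
  "eqv3 r (p, q) (s, t) = sup_el r (inf_el r p s) (inf_el r q t)"

definition comparable :: "('a \<Rightarrow> 'a \<Rightarrow> 'a rl) \<Rightarrow> 'a el \<Rightarrow> 'a el \<Rightarrow> bool" where
  "comparable r x y = (if lte r x y then True else lte r y x)"

text \<open>For a plain pair the join defining the level-3 value collapses to one of its two
  joinands.\<close>

fun plain :: "('a \<Rightarrow> 'a \<Rightarrow> 'a rl) \<Rightarrow> 'a pair \<Rightarrow> 'a pair \<Rightarrow> bool" where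
  "plain r (p, q) (s, t) = comparable r (inf_el r p s) (inf_el r q t)"

type_synonym 'a spor = "(('a pair \<times> 'a pair) \<times> 'a el) list"

text \<open>A pair \<open>X = (p, q)\<close> stands for \<open>(x \<rightarrow> c, x' \<rightarrow> c)\<close>. The function \<open>U\<close> of the introduction is the
  level-3 equivalence, except for the finitely many entries of a list of type \<open>spor\<close>, where short
  cycles of blocks force a larger value.\<close>

definition bound :: "('a \<Rightarrow> 'a \<Rightarrow> 'a rl) \<Rightarrow> 'a spor \<Rightarrow> 'a pair \<Rightarrow> 'a pair \<Rightarrow> 'a el" where
  "bound r sp X Y = (case map_of sp (X, Y) of None \<Rightarrow> eqv3 r X Y | Some u \<Rightarrow> u)"

text \<open>Lists only what has to be checked: \<open>Y = X\<close> is trivial, and unexceptional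
  plain pairs are settled by \<open>diag_ok\<close> alone, through \<open>plain_le\<close>.\<close>

definition row :: "('a \<Rightarrow> 'a \<Rightarrow> 'a rl) \<Rightarrow> 'a spor \<Rightarrow> 'a pair list \<Rightarrow> 'a pair \<Rightarrow> ('a pair \<times> 'a el) list" where
  "row r sp Ps X =
     map (\<lambda>Y. (Y, eqv3 r X Y)) (filter (\<lambda>Y. if plain r X Y then False else X \<noteq> Y) Ps)
     @ map (\<lambda>e. (snd (fst e), snd e)) (filter (\<lambda>e. fst (fst e) = X) sp)"

text \<open>The first three conditions say that the pairwise meets of \<open>p\<close>,
  \<open>q\<close>, \<open>c\<close> coincide; they settle the plain pairs. The last makes the
  level-3 value of a pair with itself equal to \<open>Top\<close>.\<close>

fun diag_ok :: "('a \<Rightarrow> 'a \<Rightarrow> 'a rl) \<Rightarrow> 'a el \<Rightarrow> 'a pair \<Rightarrow> bool" where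
  "diag_ok r c (p, q) \<longleftrightarrow> lte r (inf_el r p q) c \<and> lte r (inf_el r q c) p \<and> lte r (inf_el r p c) q
     \<and> lte r Top (sup_el r p q)"

fun entry_ok :: "('a \<Rightarrow> 'a \<Rightarrow> 'a rl) \<Rightarrow> 'a pair \<Rightarrow> 'a pair \<times> 'a el \<Rightarrow> bool" where
  "entry_ok r (p, q) ((s, t), u) \<longleftrightarrow> lte r (inf_el r p u) s \<and> lte r (inf_el r q u) t"

text \<open>Under \<open>sp_ok\<close> this amounts to the second test alone; the first one avoids
  the lookup in \<open>sp\<close>.\<close>

definition below :: "('a \<Rightarrow> 'a \<Rightarrow> 'a rl) \<Rightarrow> 'a spor \<Rightarrow> 'a el \<Rightarrow> 'a pair \<Rightarrow> 'a pair \<Rightarrow> bool" where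
  "below r sp v Y Z = (if lte r v (eqv3 r Y Z) then True else lte r v (bound r sp Y Z))"

text \<open>Each two entries are compared in one order only, which suffices because meets and bounds
  are symmetric.\<close>

primrec row_trans :: "('a \<Rightarrow> 'a \<Rightarrow> 'a rl) \<Rightarrow> 'a spor \<Rightarrow> ('a pair \<times> 'a el) list \<Rightarrow> bool" where
  "row_trans r sp [] = True"
| "row_trans r sp (e # R) =
     (list_all (\<lambda>e'. below r sp (inf_el r (snd e) (snd e')) (fst e) (fst e')) R \<and> row_trans r sp R)"

definition sp_ok :: "('a \<Rightarrow> 'a \<Rightarrow> 'a rl) \<Rightarrow> 'a spor \<Rightarrow> bool" where
  "sp_ok r sp = list_all (\<lambda>((X, Y), u). bound r sp Y X = bound r sp X Y
     \<and> bound r sp (prod.swap X) (prod.swap Y) = bound r sp X Y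
     \<and> lte r (eqv3 r X Y) (bound r sp X Y)) sp"

definition row_le :: "('a \<Rightarrow> 'a \<Rightarrow> 'a rl) \<Rightarrow> 'a el \<Rightarrow> 'a pair \<Rightarrow> ('a pair \<times> 'a el) list \<Rightarrow> bool" where
  "row_le r c X R \<longleftrightarrow> diag_ok r c X \<and> list_all (entry_ok r X) R"

definition row_ok :: "('a \<Rightarrow> 'a \<Rightarrow> 'a rl) \<Rightarrow> 'a el \<Rightarrow> 'a spor \<Rightarrow> 'a pair \<Rightarrow> ('a pair \<times> 'a el) list \<Rightarrow> bool" where
  "row_ok r c sp X R \<longleftrightarrow> row_le r c X R \<and> row_trans r sp R"

text \<open>Passing from \<open>x\<close> to its complement swaps the components of its pair, so
  \<open>H\<close> needs only one of the two pairs.\<close>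

definition saturate :: "'a pair list \<Rightarrow> 'a pair list" where
  "saturate H = H @ filter (\<lambda>X. X \<notin> set H) (map prod.swap H)"

definition rows_le :: "('a \<Rightarrow> 'a \<Rightarrow> 'a rl) \<Rightarrow> 'a el \<Rightarrow> 'a spor \<Rightarrow> 'a pair list \<Rightarrow> 'a pair list \<Rightarrow> bool" where
  "rows_le r c sp H Ps = list_all (\<lambda>X. row_le r c X (row r sp Ps X)) H"

definition rows_ok :: "('a \<Rightarrow> 'a \<Rightarrow> 'a rl) \<Rightarrow> 'a el \<Rightarrow> 'a spor \<Rightarrow> 'a pair list \<Rightarrow> 'a pair list \<Rightarrow> bool" where
  "rows_ok r c sp H Ps = list_all (\<lambda>X. row_ok r c sp X (row r sp Ps X)) H"

definition elements :: "'a list \<Rightarrow> 'a el list" where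
  "elements as = Bot # Top # map At as @ map Co as"

lemma mem_elements: "set as = UNIV \<Longrightarrow> x \<in> set (elements as)"
  by (cases x) (auto simp: elements_def)

definition reps :: "('a \<Rightarrow> 'a \<Rightarrow> 'a rl) \<Rightarrow> 'a list \<Rightarrow> 'a el \<Rightarrow> 'a pair list" where
  "reps r as c = remdups (map (pq r c) (Bot # map At as))"

type_synonym 'a hint = "('a el \<times> 'a el \<times> 'a el) list"

text \<open>Replacing \<open>x, y\<close> by \<open>y, x\<close> or by \<open>x', y'\<close> does not change the equivalence, so one entry of a hint
  accounts for four exceptional pairs.\<close>

definition expand :: "('a \<Rightarrow> 'a \<Rightarrow> 'a rl) \<Rightarrow> 'a el \<Rightarrow> 'a hint \<Rightarrow> 'a spor" where
  "expand r c hs = concat (map (\<lambda>(x, y, u).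
     [((pq r c x, pq r c y), u), ((pq r c y, pq r c x), u),
      ((pq r c (neg x), pq r c (neg y)), u), ((pq r c (neg y), pq r c (neg x)), u)]) hs)"

definition cert_ok :: "('a \<Rightarrow> 'a \<Rightarrow> 'a rl) \<Rightarrow> 'a el \<Rightarrow> 'a spor \<Rightarrow> 'a pair list \<Rightarrow> bool" where
  "cert_ok r c sp H \<longleftrightarrow> sp_ok r sp \<and> rows_ok r c sp H (saturate H)"

definition local_ok :: "('a \<Rightarrow> 'a \<Rightarrow> 'a rl) \<Rightarrow> 'a el \<Rightarrow> 'a pair list \<Rightarrow> bool" where
  "local_ok r c H = rows_le r c [] H (saturate H)"

definition full_ok :: "('a \<Rightarrow> 'a \<Rightarrow> 'a rl) \<Rightarrow> 'a list \<Rightarrow> 'a el \<times> 'a hint \<Rightarrow> bool" where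
  "full_ok r as ch = cert_ok r (fst ch) (expand r (fst ch) (snd ch)) (reps r as (fst ch))"

text \<open>The pairs of the atom and of its complement are removed together, since
  \<open>saturate\<close> would restore either one from the other.\<close>

definition drop_ok :: "('a \<Rightarrow> 'a \<Rightarrow> 'a rl) \<Rightarrow> 'a list \<Rightarrow> 'a el \<Rightarrow> 'a \<times> 'a hint \<Rightarrow> bool" where
  "drop_ok r as c ah = cert_ok r c (expand r c (snd ah))
     (filter (\<lambda>X. X \<noteq> pq r c (At (fst ah)) \<and> X \<noteq> pq r c (Co (fst ah))) (reps r as c))"

lemma mem_saturate: "X \<in> set (saturate H) \<longleftrightarrow> X \<in> set H \<or> prod.swap X \<in> set H"
  unfolding saturate_def by (cases X) force

lemma list_all_row_trans:
  assumes "row_trans r sp R" "e \<in> set R" "e' \<in> set R" "e \<noteq> e'"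
  shows "below r sp (inf_el r (snd e) (snd e')) (fst e) (fst e')
    \<or> below r sp (inf_el r (snd e') (snd e)) (fst e') (fst e)"
  using assms by (induction R) (auto simp: list_all_iff)

section \<open>Soundness of the certificates\<close>

context graph
begin

interpretation ortholat "graph_ol r"
  by unfold_locales (rule ortholattice_graph_ol)

lemma ol_sel:
  "carrier (graph_ol r) = UNIV" "le (graph_ol r) = lte r" "meet (graph_ol r) = inf_el r"
  "join (graph_ol r) = sup_el r" "compl (graph_ol r) = neg"
  by (simp_all add: graph_ol_def)

lemma oimp_graph_ol: "oimp (graph_ol r) x c = imp r x c"
  by (simp add: oimp_def imp_def ol_sel)

lemma oeqv_graph_ol: "oeqv (graph_ol r) a 3 x y = eqv3 r (pq r (a 3) x) (pq r (a 3) y)"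
  by (simp add: numeral_3_eq_3 ol_sel oimp_graph_ol pq_def)

lemma inf_el_lower2: "lte r (inf_el r x y) y"
  using inf_el_lower[of y x] by (simp add: inf_el_comm)

lemma inf_el_mono: "lte r x x' \<Longrightarrow> lte r y y' \<Longrightarrow> lte r (inf_el r x y) (inf_el r x' y')"
  by (meson inf_el_lower inf_el_lower2 inf_el_greatest lte_trans)

lemma sup_el_absorb: "lte r x y \<Longrightarrow> sup_el r x y = y" "lte r y x \<Longrightarrow> sup_el r x y = x"
  by (meson lte_antisym sup_el_upper sup_el_least lte_refl)+

lemma inf_el_idem: "inf_el r x x = x"
  by (cases x) (simp_all add: rel_self)

lemma eqv3_comm: "eqv3 r X Y = eqv3 r Y X"
  by (cases X; cases Y) (simp add: inf_el_comm)

lemma eqv3_upper: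
  "lte r (inf_el r (fst X) (fst Y)) (eqv3 r X Y)" "lte r (inf_el r (snd X) (snd Y)) (eqv3 r X Y)"
  by (cases X; cases Y; simp add: sup_el_upper)+

lemma eqv3_plain:
  assumes "plain r X Y"
  shows "eqv3 r X Y = inf_el r (fst X) (fst Y) \<or> eqv3 r X Y = inf_el r (snd X) (snd Y)"
  using assms by (cases X; cases Y) (auto simp: comparable_def sup_el_absorb split: if_splits)

lemma eqv3_swap: "eqv3 r (prod.swap X) (prod.swap Y) = eqv3 r X Y"
  by (cases X; cases Y) (simp add: sup_el_def inf_el_comm)

text \<open>\<open>sp_ok\<close> speaks of listed pairs only. If just the swapped pair is listed,
  the test is applied to that one, swapping being an involution; if neither is,
  \<open>eqv3_swap\<close> applies.\<close>

lemma bound_swap: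
  assumes sp: "sp_ok r sp"
  shows "bound r sp (prod.swap X) (prod.swap Y) = bound r sp X Y"
proof -
  have *: "bound r sp (prod.swap V) (prod.swap W) = bound r sp V W" if "map_of sp (V, W) = Some u" for u V W
    using sp map_of_SomeD[OF that] unfolding sp_ok_def list_all_iff by fastforce
  show ?thesis
  proof (cases "map_of sp (X, Y)")
    case None
    show ?thesis
    proof (cases "map_of sp (prod.swap X, prod.swap Y)")
      case None
      with \<open>map_of sp (X, Y) = None\<close> show ?thesis by (simp add: bound_def eqv3_swap)
    next
      case (Some u)
      then show ?thesis using *[OF Some] by simp
    qed
  qed (use * in metis)
qed

lemma bound_comm: "sp_ok r sp \<Longrightarrow> bound r sp X Y = bound r sp Y X"
proof -
  assume sp: "sp_ok r sp"
  have *: "bound r sp V W = bound r sp W V" if "map_of sp (V, W) = Some u" for u V W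
    using sp map_of_SomeD[OF that] unfolding sp_ok_def list_all_iff by fastforce
  show ?thesis
  proof (cases "map_of sp (X, Y)")
    case None
    show ?thesis
    proof (cases "map_of sp (Y, X)")
      case None
      with \<open>map_of sp (X, Y) = None\<close> show ?thesis by (simp add: bound_def eqv3_comm)
    qed (use * in metis)
  qed (use * in metis)
qed

lemma eqv3_le_bound:
  assumes "sp_ok r sp"
  shows "lte r (eqv3 r X Y) (bound r sp X Y)"
proof (cases "map_of sp (X, Y)")
  case None
  then show ?thesis by (simp add: bound_def lte_refl)
next
  case (Some u)
  then show ?thesis
    using assms map_of_SomeD[OF Some] unfolding sp_ok_def list_all_iff by fastforce
qed

lemma row_cases:
  assumes "Y \<in> set Ps" "X \<noteq> Y"
  obtains "plain r X Y" "bound r sp X Y = eqv3 r X Y" | "(Y, bound r sp X Y) \<in> set (row r sp Ps X)"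
proof (cases "map_of sp (X, Y)")
  case None
  then show thesis
    using that assms by (cases "plain r X Y") (auto simp: bound_def row_def)
next
  case (Some u)
  have "(Y, u) \<in> set (row r sp Ps X)"
    using map_of_SomeD[OF Some] unfolding row_def by force
  then show thesis using that Some by (simp add: bound_def)
qed

context
  fixes c :: "'a el" and sp :: "'a spor" and H Ps :: "'a pair list"
  assumes sp: "sp_ok r sp" and loc: "rows_le r c sp H Ps" and Ps: "Ps = saturate H"
begin

lemma diag:
  assumes "(p, q) \<in> set Ps"
  shows "lte r (inf_el r p q) c" "lte r (inf_el r q c) p" "lte r (inf_el r p c) q" "sup_el r p q = Top"
proof -
  have "diag_ok r c (p, q) \<or> diag_ok r c (q, p)"
    using loc assms unfolding Ps mem_saturate rows_le_def row_le_def list_all_iff by auto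
  then have *: "diag_ok r c (p, q)"
    by (auto simp: inf_el_comm sup_el_def)
  then show "lte r (inf_el r p q) c" "lte r (inf_el r q c) p" "lte r (inf_el r p c) q" by simp_all
  show "sup_el r p q = Top" using * by (cases "sup_el r p q") simp_all
qed

lemma plain_le:
  assumes "(p, q) \<in> set Ps" "(s, t) \<in> set Ps" "plain r (p, q) (s, t)"
  shows "lte r (inf_el r p (eqv3 r (p, q) (s, t))) s" "lte r (inf_el r q (eqv3 r (p, q) (s, t))) t"
proof -
  have "lte r (inf_el r p (inf_el r q t)) (inf_el r t c)"
    using diag(1)[OF assms(1)] by (meson inf_el_greatest inf_el_lower inf_el_lower2 lte_trans)
  then have 1: "lte r (inf_el r p (inf_el r q t)) s"
    using diag(2)[OF assms(2)] lte_trans by blast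
  have "lte r (inf_el r q (inf_el r p s)) (inf_el r s c)"
    using diag(1)[OF assms(1)] by (meson inf_el_greatest inf_el_lower inf_el_lower2 lte_trans)
  then have 2: "lte r (inf_el r q (inf_el r p s)) t"
    using diag(3)[OF assms(2)] lte_trans by blast
  have 3: "lte r (inf_el r p (inf_el r p s)) s" "lte r (inf_el r q (inf_el r q t)) t"
    by (meson inf_el_lower2 lte_trans)+
  show "lte r (inf_el r p (eqv3 r (p, q) (s, t))) s" "lte r (inf_el r q (eqv3 r (p, q) (s, t))) t"
    using eqv3_plain[OF assms(3)] 1 2 3 by auto
qed

lemma bound_le_rep:
  assumes X: "X \<in> set H" and Y: "Y \<in> set Ps"
  shows "lte r (inf_el r (fst X) (bound r sp X Y)) (fst Y)
    \<and> lte r (inf_el r (snd X) (bound r sp X Y)) (snd Y)"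
proof (cases "X = Y")
  case True
  then show ?thesis by (simp add: inf_el_lower)
next
  case False
  obtain p q s t where pq: "X = (p, q)" "Y = (s, t)" by (metis surj_pair)
  from Y False show ?thesis
  proof (cases rule: row_cases[where sp = sp])
    case 1
    moreover have "X \<in> set Ps" using X by (simp add: Ps mem_saturate)
    ultimately show ?thesis using plain_le Y pq by simp
  next
    case 2
    then have "entry_ok r X (Y, bound r sp X Y)"
      using loc X unfolding rows_le_def row_le_def list_all_iff by blast
    then show ?thesis using pq by simp
  qed
qed

text \<open>Swapping both pairs leaves the bound unchanged, so the rows of \<open>H\<close> decide
  the matter for all of \<open>Ps\<close>.\<close>

lemma bound_le:
  assumes X: "X \<in> set Ps" and Y: "Y \<in> set Ps"
  shows "lte r (inf_el r (fst X) (bound r sp X Y)) (fst Y)"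
    and "lte r (inf_el r (snd X) (bound r sp X Y)) (snd Y)"
proof -
  have "prod.swap Y \<in> set Ps" using Y by (auto simp: Ps mem_saturate)
  moreover from X have "X \<in> set H \<or> prod.swap X \<in> set H" by (simp add: Ps mem_saturate)
  ultimately have "lte r (inf_el r (fst X) (bound r sp X Y)) (fst Y)
      \<and> lte r (inf_el r (snd X) (bound r sp X Y)) (snd Y)"
    using bound_le_rep[of X Y] bound_le_rep[of "prod.swap X" "prod.swap Y"] Y bound_swap[OF sp] by auto
  then show "lte r (inf_el r (fst X) (bound r sp X Y)) (fst Y)"
    and "lte r (inf_el r (snd X) (bound r sp X Y)) (snd Y)" by simp_all
qed

text \<open>If \<open>X, Z\<close> is plain, its bound is a meet of two first or two second components, so the
  inequalities of the previous lemma push the meet below both components; only two non-plain pairs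
  require the table.\<close>

lemma bound_trans_rep:
  assumes tr: "rows_ok r c sp H Ps"
    and X: "X \<in> set Ps" and Y: "Y \<in> set Ps" and ZH: "Z \<in> set H"
  shows "lte r (inf_el r (bound r sp X Z) (bound r sp Y Z)) (bound r sp X Y)"
proof -
  have Z: "Z \<in> set Ps" using ZH by (simp add: Ps mem_saturate)
  have one: "lte r (inf_el r (bound r sp V Z) (bound r sp Z W)) (bound r sp V W)"
    if pl: "plain r V Z" "bound r sp V Z = eqv3 r V Z" and VW: "V \<in> set Ps" "W \<in> set Ps" for V W
  proof -
    let ?m = "inf_el r (bound r sp V Z) (bound r sp Z W)"
    from eqv3_plain[OF pl(1)] have "lte r ?m (eqv3 r V W)"
    proof
      assume e: "eqv3 r V Z = inf_el r (fst V) (fst Z)"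
      have "lte r ?m (inf_el r (fst Z) (bound r sp Z W))"
        unfolding pl(2) e by (intro inf_el_mono inf_el_lower2 lte_refl)
      then have "lte r ?m (fst W)" using bound_le(1)[OF Z VW(2)] lte_trans by blast
      moreover have "lte r ?m (fst V)"
        unfolding pl(2) e by (meson inf_el_lower lte_trans)
      ultimately have "lte r ?m (inf_el r (fst V) (fst W))" by (simp add: inf_el_greatest)
      then show ?thesis using eqv3_upper(1) lte_trans by blast
    next
      assume e: "eqv3 r V Z = inf_el r (snd V) (snd Z)"
      have "lte r ?m (inf_el r (snd Z) (bound r sp Z W))"
        unfolding pl(2) e by (intro inf_el_mono inf_el_lower2 lte_refl)
      then have "lte r ?m (snd W)" using bound_le(2)[OF Z VW(2)] lte_trans by blast
      moreover have "lte r ?m (snd V)"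
        unfolding pl(2) e by (meson inf_el_lower lte_trans)
      ultimately have "lte r ?m (inf_el r (snd V) (snd W))" by (simp add: inf_el_greatest)
      then show ?thesis using eqv3_upper(2) lte_trans by blast
    qed
    then show ?thesis using eqv3_le_bound[OF sp] lte_trans by blast
  qed
  note comm = bound_comm[OF sp]
  consider "X = Z" | "Y = Z" | "X = Y" | "X \<noteq> Z" "Y \<noteq> Z" "X \<noteq> Y" by blast
  then show ?thesis
  proof cases
    case 1
    then show ?thesis using inf_el_lower2 comm[of Y Z] by simp
  next
    case 2
    then show ?thesis using inf_el_lower by simp
  next
    case 3
    obtain p q where "X = (p, q)" by force
    then have "eqv3 r X X = Top" using diag(4) X by (simp add: sup_el_absorb lte_refl inf_el_idem)
    then have "lte r Top (bound r sp X X)" using eqv3_le_bound[OF sp, of X X] by simp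
    moreover have "lte r v Top" for v by (cases v) simp_all
    ultimately show ?thesis using lte_trans 3 by blast
  next
    case 4
    show ?thesis
    proof (cases rule: row_cases[OF X 4(1)[symmetric], where sp = sp])
      case 1
      then have "plain r X Z"
        by (cases X; cases Z) (simp add: inf_el_comm)
      then show ?thesis
        using one[of X Y] 1(2) X Y comm eqv3_comm by metis
    next
      case XZ: 2
      show ?thesis
      proof (cases rule: row_cases[OF Y 4(2)[symmetric], where sp = sp])
        case 1
        then have "plain r Y Z"
          by (cases Y; cases Z) (simp add: inf_el_comm)
        then show ?thesis
          using one[of Y X] 1(2) X Y comm eqv3_comm inf_el_comm by metis
      next
        case YZ: 2
        have "row_trans r sp (row r sp Ps Z)"
          using tr ZH unfolding rows_ok_def row_ok_def list_all_iff by blast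
        then have "below r sp (inf_el r (bound r sp Z X) (bound r sp Z Y)) X Y
            \<or> below r sp (inf_el r (bound r sp Z Y) (bound r sp Z X)) Y X"
          using list_all_row_trans[OF _ XZ YZ] 4 by simp
        then have "lte r (inf_el r (bound r sp Z X) (bound r sp Z Y)) (bound r sp X Y)"
          using eqv3_le_bound[OF sp] lte_trans comm inf_el_comm unfolding below_def by metis
        then show ?thesis by (simp add: comm)
      qed
    qed
  qed
qed

lemma bound_trans:
  assumes tr: "rows_ok r c sp H Ps"
    and X: "X \<in> set Ps" and Y: "Y \<in> set Ps" and Z: "Z \<in> set Ps"
  shows "lte r (inf_el r (bound r sp X Z) (bound r sp Y Z)) (bound r sp X Y)"
proof -
  have "prod.swap X \<in> set Ps" "prod.swap Y \<in> set Ps"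
    using X Y by (auto simp: Ps mem_saturate)
  moreover from Z have "Z \<in> set H \<or> prod.swap Z \<in> set H" by (simp add: Ps mem_saturate)
  ultimately show ?thesis
    using bound_trans_rep[OF tr X Y, of Z]
      bound_trans_rep[OF tr, of "prod.swap X" "prod.swap Y" "prod.swap Z"] bound_swap[OF sp] by auto
qed

end

lemma mem_reps:
  assumes "set as = UNIV"
  shows "pq r c x \<in> set (reps r as c) \<or> prod.swap (pq r c x) \<in> set (reps r as c)"
  using assms by (cases x) (auto simp: reps_def pq_def)

lemma rows_le_if_ok: "rows_ok r c sp H Ps \<Longrightarrow> rows_le r c sp H Ps"
  by (simp add: rows_ok_def rows_le_def row_ok_def list_all_iff)

text \<open>With \<open>n = 3\<close> the recursion is never entered, so no transitivity is checked;
  for the empty list of exceptions the bound is the level-3 value itself.\<close>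

lemma nOA_three:
  assumes as: "set as = UNIV" and ok: "\<And>c. local_ok r c (reps r as c)"
  shows "nOA (graph_ol r) 3"
  unfolding nOA_def
proof (intro allI impI)
  fix a :: "nat \<Rightarrow> 'a el"
  have "sp_ok r []" by (simp add: sp_ok_def)
  then have "lte r (inf_el r (fst (pq r (a 3) (a 1))) (bound r [] (pq r (a 3) (a 1)) (pq r (a 3) (a 2))))
      (fst (pq r (a 3) (a 2)))"
    by (rule bound_le(1)[OF _ ok[of "a 3", unfolded local_ok_def] refl])
      (simp_all add: mem_saturate mem_reps[OF as])
  then show "le (graph_ol r) (meet (graph_ol r) (oimp (graph_ol r) (a 1) (a 3))
      (oeqv (graph_ol r) a 3 (a 1) (a 2))) (oimp (graph_ol r) (a 2) (a 3))"
    unfolding oeqv_graph_ol oimp_graph_ol ol_sel by (simp add: bound_def pq_def)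
qed

lemma nOA_if_certificate:
  assumes as: "set as = UNIV" and n: "3 \<le> n"
    and full: "list_all (full_ok r as) hs"
    and cover: "\<And>x. x \<noteq> c \<Longrightarrow> x \<in> fst ` set hs"
    and drops: "list_all (drop_ok r as c) ds" "length ds = n"
    and dist: "distinct (map (\<lambda>d. pq r c (At (fst d))) ds @ map (\<lambda>d. pq r c (Co (fst d))) ds)"
  shows "nOA (graph_ol r) n"
proof (rule nOA_if_bound[OF n])
  fix a :: "nat \<Rightarrow> 'a el"
  let ?P = "pq r (a 3)"
  have "\<exists>sp H. cert_ok r (a 3) sp H \<and> (\<forall>i\<in>{1..n} - {3}. ?P (a i) \<in> set (saturate H))"
  proof (cases "a 3 = c")
    case False
    then obtain h where "(a 3, h) \<in> set hs" using cover by force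
    then have "full_ok r as (a 3, h)" using full by (auto simp: list_all_iff)
    then show ?thesis using mem_reps[OF as] unfolding full_ok_def mem_saturate by auto
  next
    case True
    define miss where "miss j i \<longleftrightarrow> ?P (a i) \<noteq> pq r c (At (fst (ds ! j))) \<and> ?P (a i) \<noteq> pq r c (Co (fst (ds ! j)))"
      for i j
    have disj: "j = k" if jk: "j < n" "k < n" and hit: "\<not> miss j i" "\<not> miss k i" for i j k
    proof -
      let ?f = "\<lambda>d. pq r c (At (fst d))" and ?g = "\<lambda>d. pq r c (Co (fst d))"
      \<comment> \<open>By \<open>dist\<close> the \<open>2 n\<close> dropped pairs are all
        different, so the pair of one variable can hit at most one entry of
        \<open>ds\<close>.\<close>
      have "?f ` set ds \<inter> ?g ` set ds = {}" using dist by simp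
      moreover have "ds ! j \<in> set ds" "ds ! k \<in> set ds" using jk drops(2) by simp_all
      ultimately have "?f (ds ! j) \<noteq> ?g (ds ! k)" "?g (ds ! j) \<noteq> ?f (ds ! k)" by blast+
      then have "?f (ds ! j) = ?f (ds ! k) \<or> ?g (ds ! j) = ?g (ds ! k)"
        using hit unfolding miss_def by metis
      moreover have "?f (ds ! j) = ?f (ds ! k) \<longleftrightarrow> j = k" "?g (ds ! j) = ?g (ds ! k) \<longleftrightarrow> j = k"
        using dist jk drops(2) nth_eq_iff_index_eq[of "map ?f ds" j k]
          nth_eq_iff_index_eq[of "map ?g ds" j k] by simp_all
      ultimately show ?thesis by blast
    qed
    \<comment> \<open>Pigeonhole: each of the \<open>n\<close> entries would be hit by some
      variable, different entries by different ones, but only \<open>n - 1\<close> indices differ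
      from 3.\<close>
    have "\<exists>j<n. \<forall>i\<in>{1..n} - {3}. miss j i"
    proof (rule ccontr)
      assume "\<not> ?thesis"
      then obtain f where f: "\<And>j. j < n \<Longrightarrow> f j \<in> {1..n} - {3} \<and> \<not> miss j (f j)"
        by metis
      have "inj_on f {..<n}"
        using f disj by (intro inj_onI) (metis lessThan_iff)
      moreover have "f ` {..<n} \<subseteq> {1..n} - {3}" using f by auto
      ultimately have "n \<le> card ({1..n} - {3})"
        using card_inj_on_le[of f "{..<n}" "{1..n} - {3}"] by simp
      then show False using n by (simp add: card_Diff_singleton_if)
    qed
    then obtain j where j: "j < n" "\<And>i. i \<in> {1..n} - {3} \<Longrightarrow> miss j i" by blast
    have "drop_ok r as c (ds ! j)" using drops j(1) by (simp add: list_all_length)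
    moreover have "?P (a i) \<in> set (saturate (filter (\<lambda>X. X \<noteq> pq r c (At (fst (ds ! j)))
        \<and> X \<noteq> pq r c (Co (fst (ds ! j)))) (reps r as c)))" if "i \<in> {1..n} - {3}" for i
      using j(2)[OF that] mem_reps[OF as, of "a 3" "a i"] True
      unfolding mem_saturate miss_def by (auto simp: pq_def)
    ultimately show ?thesis
      unfolding drop_ok_def True by blast
  qed
  then obtain sp H where "cert_ok r (a 3) sp H"
    and aP: "\<forall>i\<in>{1..n} - {3}. ?P (a i) \<in> set (saturate H)"
    by blast
  then have sp: "sp_ok r sp" and ok: "rows_ok r (a 3) sp H (saturate H)"
    by (simp_all add: cert_ok_def)
  note le = rows_le_if_ok[OF ok]
  \<comment> \<open>\<open>X\<close> consists of the elements whose pair survives in the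
    certificate, and \<open>U\<close> depends on elements only through their pairs.\<close>
  let ?X = "{x. ?P x \<in> set (saturate H)}" and ?U = "\<lambda>x y. bound r sp (?P x) (?P y)"
  have "lte r (inf_el r (imp r x (a 3)) (?U x y)) (imp r y (a 3))" if "x \<in> ?X" "y \<in> ?X" for x y
    using bound_le(1)[OF sp le refl, of "?P x" "?P y"] that by (simp add: pq_def)
  then show "\<exists>X U. X \<subseteq> carrier (graph_ol r) \<and> (\<forall>i\<in>{1..n} - {3}. a i \<in> X)
        \<and> (\<forall>x\<in>X. \<forall>y\<in>X. U x y \<in> carrier (graph_ol r)
             \<and> le (graph_ol r) (oeqv (graph_ol r) a 3 x y) (U x y)
             \<and> le (graph_ol r) (meet (graph_ol r) (oimp (graph_ol r) x (a 3)) (U x y)) (oimp (graph_ol r) y (a 3)))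
        \<and> (\<forall>x\<in>X. \<forall>y\<in>X. \<forall>z\<in>X. le (graph_ol r) (meet (graph_ol r) (U x z) (U y z)) (U x y))"
    unfolding oeqv_graph_ol oimp_graph_ol ol_sel
    using aP eqv3_le_bound[OF sp] bound_trans[OF sp le refl ok]
    by (intro exI[of _ ?X] exI[of _ ?U]) auto
qed

lemma separating_ol_in_nat:
  fixes as :: "'a list"
  assumes as: "set as = UNIV" and n: "3 \<le> n"
    and OA: "nOA (graph_ol r) n" "\<not> nOA (graph_ol r) (n + 1)"
  shows "\<exists>K :: nat ol. ortholattice K \<and> orthomodular K \<and> finite (carrier K)
    \<and> nOA K n \<and> \<not> nOA K (n + 1)"
proof (rule finite_ol_in_nat[OF _ orthomodular_graph_ol n OA])
  have "(UNIV :: 'a el set) = set (elements as)"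
    using mem_elements[OF as] by blast
  then show "finite (UNIV :: 'a el set)" by (metis List.finite_set)
qed

lemma not_nOA_graph_ol:
  assumes "\<not> lte r (inf_el r (imp r (a 1) (a 3)) (oeqv (graph_ol r) a n (a 1) (a 2))) (imp r (a 2) (a 3))"
  shows "\<not> nOA (graph_ol r) n"
  using assms unfolding nOA_def oimp_graph_ol ol_sel by blast

end

section \<open>Checking the graph conditions on a table\<close>

text \<open>For \<open>unique\<close>, \<open>b\<close> is the common neighbour and \<open>e\<close>
  the second atom, so the search over \<open>e\<close> is confined to orthogonal \<open>a\<close>,
  \<open>b\<close>.\<close>

definition entry_valid :: "('a \<Rightarrow> 'a \<Rightarrow> 'a rl) \<Rightarrow> 'a list \<Rightarrow> 'a \<Rightarrow> 'a \<Rightarrow> bool" where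
  "entry_valid r as a b \<longleftrightarrow> isS (r a b) = (a = b) \<and> r a b = r b a
     \<and> (case r a b of S \<Rightarrow> True | F \<Rightarrow> True | N g \<Rightarrow> r a g = N b | D g \<Rightarrow> isN (r a g) \<and> isN (r g b))
     \<and> (if isN (r a b) then list_all (\<lambda>e. if isN (r b e) then a = e \<or> r a e = N b \<or> r a e = D b else True) as
        else True)"

definition graph_valid :: "('a \<Rightarrow> 'a \<Rightarrow> 'a rl) \<Rightarrow> 'a list \<Rightarrow> bool" where
  "graph_valid r as = list_all (\<lambda>a. list_all (entry_valid r as a) as) as"

lemma graph_if_valid:
  assumes as: "set as = UNIV" and valid: "graph_valid r as"
  shows "graph r"
proof
  have *: "entry_valid r as a b" for a b
    using as valid unfolding graph_valid_def list_all_iff by blast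
  fix a b g
  show "isS (r a b) = (a = b)" "r a b = r b a"
    using *[of a b] unfolding entry_valid_def by blast+
  have "case r a b of S \<Rightarrow> True | F \<Rightarrow> True | N g \<Rightarrow> r a g = N b | D g \<Rightarrow> isN (r a g) \<and> isN (r g b)"
    using *[of a b] unfolding entry_valid_def by blast
  then show "r a b = N g \<Longrightarrow> r a g = N b" "r a b = D g \<Longrightarrow> isN (r a g) \<and> isN (r g b)"
    by simp_all
  show "r a b = N g \<or> r a b = D g" if "isN (r a g)" "isN (r g b)" "a \<noteq> b"
    using *[of a g] that as unfolding entry_valid_def list_all_iff by (metis UNIV_I)
qed

section \<open>The three lattices\<close>

datatype atom17 = A0 | A1 | A2 | A3 | A4 | A5 | A6 | A7 | A8 | A9 | A10 | A11 | A12 | A13 | A14 | A15 | A16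

text \<open>Ten blocks, given by the indices of their atoms: 0-1-2, 1-9-13, 2-3-15, 2-8-12, 4-5-15,
  5-7-13, 6-15-16, 7-12-14, 9-10-16, 11-14-16.\<close>

primrec r17 :: "atom17 \<Rightarrow> atom17 \<Rightarrow> atom17 rl" where
  "r17 A0 = case_atom17 S (N A2) (N A1) (D A2) F F F F (D A2) (D A1) F F (D A2) (D A1) F (D A2) F"
| "r17 A1 = case_atom17 (N A2) S (N A0) (D A2) F (D A13) F (D A13) (D A2) (N A13) (D A9) F (D A2)
     (N A9) F (D A2) (D A9)"
| "r17 A2 = case_atom17 (N A1) (N A0) S (N A15) (D A15) (D A15) (D A15) (D A12) (N A12) (D A1) F F
     (N A8) (D A1) (D A12) (N A3) (D A15)"
| "r17 A3 = case_atom17 (D A2) (D A2) (N A15) S (D A15) (D A15) (D A15) F (D A2) F F F (D A2) F F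
     (N A2) (D A15)"
| "r17 A4 = case_atom17 F F (D A15) (D A15) S (N A15) (D A15) (D A5) F F F F F (D A5) F (N A5) (D A15)"
| "r17 A5 = case_atom17 F (D A13) (D A15) (D A15) (N A15) S (D A15) (N A13) F (D A13) F F (D A7)
     (N A7) (D A7) (N A4) (D A15)"
| "r17 A6 = case_atom17 F F (D A15) (D A15) (D A15) (D A15) S F F (D A16) (D A16) (D A16) F F (D A16)
     (N A16) (N A15)"
| "r17 A7 = case_atom17 F (D A13) (D A12) F (D A5) (N A13) F S (D A12) (D A13) F (D A14) (N A14)
     (N A5) (N A12) (D A5) (D A14)"
| "r17 A8 = case_atom17 (D A2) (D A2) (N A12) (D A2) F F F (D A12) S F F F (N A2) F (D A12) (D A2) F"
| "r17 A9 = case_atom17 (D A1) (N A13) (D A1) F F (D A13) (D A16) (D A13) F S (N A16) (D A16) F (N A1)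
     (D A16) (D A16) (N A10)"
| "r17 A10 = case_atom17 F (D A9) F F F F (D A16) F F (N A16) S (D A16) F (D A9) (D A16) (D A16)
     (N A9)"
| "r17 A11 = case_atom17 F F F F F F (D A16) (D A14) F (D A16) (D A16) S (D A14) F (N A16) (D A16)
     (N A14)"
| "r17 A12 = case_atom17 (D A2) (D A2) (N A8) (D A2) F (D A7) F (N A14) (N A2) F F (D A14) S (D A7)
     (N A7) (D A2) (D A14)"
| "r17 A13 = case_atom17 (D A1) (N A9) (D A1) F (D A5) (N A7) F (N A5) F (N A1) (D A9) F (D A7) S
     (D A7) (D A5) (D A9)"
| "r17 A14 = case_atom17 F F (D A12) F F (D A7) (D A16) (N A12) (D A12) (D A16) (D A16) (N A16) (N A7)
     (D A7) S (D A16) (N A11)"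
| "r17 A15 = case_atom17 (D A2) (D A2) (N A3) (N A2) (N A5) (N A4) (N A16) (D A5) (D A2) (D A16)
     (D A16) (D A16) (D A2) (D A5) (D A16) S (N A6)"
| "r17 A16 = case_atom17 F (D A9) (D A15) (D A15) (D A15) (D A15) (N A15) (D A14) F (N A10) (N A9)
     (N A14) (D A14) (D A9) (N A11) (N A6) S"

definition as17 :: "atom17 list" where
  "as17 = [A0, A1, A2, A3, A4, A5, A6, A7, A8, A9, A10, A11, A12, A13, A14, A15, A16]"

lemma set_as17: "set as17 = UNIV"
proof -
  have "a \<in> set as17" for a by (cases a) (simp_all add: as17_def)
  then show ?thesis by blast
qed

lemma graph_r17: "graph r17"
proof (rule graph_if_valid[OF set_as17])
  show "graph_valid r17 as17" by code_simp
qed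

lemma nOA_r17: "nOA (graph_ol r17) 3"
proof (rule graph.nOA_three[OF graph_r17 set_as17])
  have "list_all (\<lambda>c. local_ok r17 c (reps r17 as17 c)) (elements as17)"
    by code_simp
  then show "local_ok r17 c (reps r17 as17 c)" for c
    using mem_elements[OF set_as17, of c] by (simp add: list_all_iff)
qed

text \<open>At \<open>c = Co A2\<close> the level-3 value of \<open>A9\<close>, \<open>A13\<close>
  is \<open>A1\<close>. Those of \<open>A9\<close>, \<open>A7\<close> and of \<open>A13\<close>,
  \<open>A7\<close> are \<open>Co A5\<close> and \<open>Co A15\<close>, which meet in
  \<open>A4\<close>; so level 4 contains the join of \<open>A1\<close> and \<open>A4\<close>, which
  is \<open>Top\<close>.\<close>

lemma not_nOA_r17: "\<not> nOA (graph_ol r17) 4"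
proof (rule graph.not_nOA_graph_ol[OF graph_r17, where a = "\<lambda>i. [Bot, At A9, At A13, Co A2, At A7] ! i"])
  let ?a = "\<lambda>i. [Bot, At A9, At A13, Co A2, At A7] ! i"
  show "\<not> lte r17 (inf_el r17 (imp r17 (?a 1) (?a 3)) (oeqv (graph_ol r17) ?a 4 (?a 1) (?a 2)))
      (imp r17 (?a 2) (?a 3))"
    by code_simp
qed

section \<open>Separating 4OA from 5OA: 22 atoms\<close>

text \<open>At \<open>c = B0'\<close> the level-3 equivalences of \<open>B8, B10\<close>, of \<open>B10, B12\<close> and of \<open>B12, B14\<close> are \<open>B5'\<close>,
  \<open>B6'\<close> and \<open>B7'\<close>, which all lie above \<open>B1\<close>, whereas that of \<open>B8, B14\<close> is the atom \<open>B2\<close>, not orthogonal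
  to \<open>B1\<close>. The chain from \<open>B8\<close> to \<open>B14\<close> makes the 5OA law fail, and removing any member breaks it.\<close>

datatype atom22 = B0 | B1 | B2 | B3 | B4 | B5 | B6 | B7 | B8 | B9 | B10 | B11 | B12 | B13 | B14 | B15 | B16 | B17 | B18 | B19 | B20 | B21

text \<open>Thirteen blocks: 0-2-16, 0-3-17, 0-4-18, 1-5-19, 1-6-20, 1-7-21, 2-8-9, 2-14-15,
  3-10-11, 4-12-13, 5-8-11, 6-10-13, 7-12-15.\<close>

primrec r22 :: "atom22 \<Rightarrow> atom22 \<Rightarrow> atom22 rl" where
  "r22 B0 = case_atom22 S F (N B16) (N B17) (N B18) F F F (D B2) (D B2) (D B3) (D B3) (D B4) (D B4)
     (D B2) (D B2) (N B2) (N B3) (N B4) F F F"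
| "r22 B1 = case_atom22 F S F F F (N B19) (N B20) (N B21) (D B5) F (D B6) (D B5) (D B7) (D B6) F
     (D B7) F F F (N B5) (N B6) (N B7)"
| "r22 B2 = case_atom22 (N B16) F S (D B0) (D B0) (D B8) F (D B15) (N B9) (N B8) F (D B8) (D B15) F
     (N B15) (N B14) (N B0) (D B0) (D B0) F F F"
| "r22 B3 = case_atom22 (N B17) F (D B0) S (D B0) (D B11) (D B10) F (D B11) F (N B11) (N B10) F
     (D B10) F F (D B0) (N B0) (D B0) F F F"
| "r22 B4 = case_atom22 (N B18) F (D B0) (D B0) S F (D B13) (D B12) F F (D B13) F (N B13) (N B12) F
     (D B12) (D B0) (D B0) (N B0) F F F"
| "r22 B5 = case_atom22 F (N B19) (D B8) (D B11) F S (D B1) (D B1) (N B11) (D B8) (D B11) (N B8) F F F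
     F F F F (N B1) (D B1) (D B1)"
| "r22 B6 = case_atom22 F (N B20) F (D B10) (D B13) (D B1) S (D B1) F F (N B13) (D B10) (D B13)
     (N B10) F F F F F (D B1) (N B1) (D B1)"
| "r22 B7 = case_atom22 F (N B21) (D B15) F (D B12) (D B1) (D B1) S F F F F (N B15) (D B12) (D B15)
     (N B12) F F F (D B1) (D B1) (N B1)"
| "r22 B8 = case_atom22 (D B2) (D B5) (N B9) (D B11) F (N B11) F F S (N B2) (D B11) (N B5) F F (D B2)
     (D B2) (D B2) F F (D B5) F F"
| "r22 B9 = case_atom22 (D B2) F (N B8) F F (D B8) F F (N B2) S F (D B8) F F (D B2) (D B2) (D B2) F F
     F F F"
| "r22 B10 = case_atom22 (D B3) (D B6) F (N B11) (D B13) (D B11) (N B13) F (D B11) F S (N B3) (D B13)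
     (N B6) F F F (D B3) F F (D B6) F"
| "r22 B11 = case_atom22 (D B3) (D B5) (D B8) (N B10) F (N B8) (D B10) F (N B5) (D B8) (N B3) S F
     (D B10) F F F (D B3) F (D B5) F F"
| "r22 B12 = case_atom22 (D B4) (D B7) (D B15) F (N B13) F (D B13) (N B15) F F (D B13) F S (N B4)
     (D B15) (N B7) F F (D B4) F F (D B7)"
| "r22 B13 = case_atom22 (D B4) (D B6) F (D B10) (N B12) F (N B10) (D B12) F F (N B6) (D B10) (N B4) S
     F (D B12) F F (D B4) F (D B6) F"
| "r22 B14 = case_atom22 (D B2) F (N B15) F F F F (D B15) (D B2) (D B2) F F (D B15) F S (N B2) (D B2)
     F F F F F"
| "r22 B15 = case_atom22 (D B2) (D B7) (N B14) F (D B12) F F (N B12) (D B2) (D B2) F F (N B7) (D B12)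
     (N B2) S (D B2) F F F F (D B7)"
| "r22 B16 = case_atom22 (N B2) F (N B0) (D B0) (D B0) F F F (D B2) (D B2) F F F F (D B2) (D B2) S
     (D B0) (D B0) F F F"
| "r22 B17 = case_atom22 (N B3) F (D B0) (N B0) (D B0) F F F F F (D B3) (D B3) F F F F (D B0) S (D B0)
     F F F"
| "r22 B18 = case_atom22 (N B4) F (D B0) (D B0) (N B0) F F F F F F F (D B4) (D B4) F F (D B0) (D B0) S
     F F F"
| "r22 B19 = case_atom22 F (N B5) F F F (N B1) (D B1) (D B1) (D B5) F F (D B5) F F F F F F F S (D B1)
     (D B1)"
| "r22 B20 = case_atom22 F (N B6) F F F (D B1) (N B1) (D B1) F F (D B6) F F (D B6) F F F F F (D B1) S
     (D B1)"
| "r22 B21 = case_atom22 F (N B7) F F F (D B1) (D B1) (N B1) F F F F (D B7) F F (D B7) F F F (D B1)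
     (D B1) S"

definition as22 :: "atom22 list" where
  "as22 = [B0, B1, B2, B3, B4, B5, B6, B7, B8, B9, B10, B11, B12, B13, B14, B15, B16, B17, B18, B19, B20, B21]"

lemma set_as22: "set as22 = UNIV"
proof -
  have "a \<in> set as22" for a by (cases a) (simp_all add: as22_def)
  then show ?thesis by blast
qed

lemma graph_r22: "graph r22"
proof (rule graph_if_valid[OF set_as22])
  show "graph_valid r22 as22" by code_simp
qed

text \<open>An entry consists of \<open>c\<close> and triples \<open>(x, y, u)\<close>, where
  \<open>u\<close> is the bound prescribed for \<open>x\<close>, \<open>y\<close>. Both hint lists
  together omit only \<open>Co B0\<close>; the division splits the computation.\<close>

definition hintsA22 :: "(atom22 el \<times> atom22 hint) list" where
  "hintsA22 = [
    (Bot, []), (Top, []), (At B0, []), (At B1, []), (At B2, []), (At B3, [(At B8, Co B13, At B1)]),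
    (At B4, [(At B10, Co B15, At B1)]), (At B5, [(At B9, Co B10, At B0)]),
    (At B6, [(At B11, Co B12, At B0)]), (At B7, [(At B13, Co B14, At B0)]),
    (At B8, [(At B3, Co B19, At B6)]), (At B9, [(At B5, Co B16, At B3)]),
    (At B10, [(At B4, Co B20, At B7), (At B5, Co B17, At B2)]), (At B11, [(At B6, Co B17, At B4)]),
    (At B12, [(At B6, Co B18, At B3)]), (At B13, [(At B3, Co B20, At B5), (At B7, Co B18, At B2)]),
    (At B14, [(At B7, Co B16, At B4)]), (At B15, [(At B4, Co B21, At B6)]),
    (At B16, [(At B9, Co B17, At B11), (At B14, Co B18, At B12)]),
    (At B17, [(At B10, Co B16, At B8), (At B11, Co B18, At B13)]),
    (At B18, [(At B12, Co B17, At B10), (At B13, Co B16, At B15)]),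
    (At B19, [(At B8, Co B20, At B10)])]"

definition hintsB22 :: "(atom22 el \<times> atom22 hint) list" where
  "hintsB22 = [
    (At B20, [(At B10, Co B21, At B12), (At B13, Co B19, At B11)]),
    (At B21, [(At B15, Co B20, At B13)]),
    (Co B1, [(At B8, At B12, At B0), (At B8, At B14, Co B16), (At B9, At B13, At B0), (At B9, At B15, Co B16), (At B9, Co B14, At B0), (At B10, At B14, At B0)]),
    (Co B2, [(At B3, Co B19, At B6), (At B4, Co B21, At B6)]), (Co B3, [(At B4, Co B20, At B7)]),
    (Co B4, [(At B3, Co B20, At B5)]), (Co B5, [(At B6, Co B17, At B4)]),
    (Co B6, [(At B5, Co B17, At B2), (At B7, Co B18, At B2)]), (Co B7, [(At B6, Co B18, At B3)]),
    (Co B8, [(At B6, Co B17, At B4)]), (Co B9, [(At B3, Co B19, At B6)]),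
    (Co B10, [(At B7, Co B18, At B2)]), (Co B11, [(At B4, Co B20, At B7)]),
    (Co B12, [(At B3, Co B20, At B5)]), (Co B13, [(At B5, Co B17, At B2)]),
    (Co B14, [(At B4, Co B21, At B6)]), (Co B15, [(At B6, Co B18, At B3)]), (Co B16, []),
    (Co B17, [(At B8, Co B13, At B1)]), (Co B18, [(At B10, Co B15, At B1)]),
    (Co B19, [(At B9, Co B10, At B0)]), (Co B20, [(At B11, Co B12, At B0)]),
    (Co B21, [(At B13, Co B14, At B0)])]"

text \<open>Without an end of the chain three consecutive members remain, and transitivity forces
  \<open>B1\<close>, the meet of two neighbouring values, as bound for the outer two. Without an
  inner member no three consecutive ones remain.\<close>

definition drops22 :: "(atom22 \<times> atom22 hint) list" where
  "drops22 = [
    (B8, [(At B10, At B14, At B1)]), (B10, []), (B12, []), (B14, [(At B8, At B12, At B1)])]"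

lemma hintsA22_ok: "list_all (full_ok r22 as22) hintsA22"
  by code_simp

lemma hintsB22_ok: "list_all (full_ok r22 as22) hintsB22"
  by code_simp

lemma drops22_ok: "list_all (drop_ok r22 as22 (Co B0)) drops22"
  by code_simp

lemma nOA_r22: "nOA (graph_ol r22) 4"
proof (rule graph.nOA_if_certificate[OF graph_r22 set_as22])
  show "list_all (full_ok r22 as22) (hintsA22 @ hintsB22)"
    by (simp add: hintsA22_ok hintsB22_ok)
  have "list_all (\<lambda>x. x = Co B0 \<or> List.member (map fst (hintsA22 @ hintsB22)) x) (elements as22)"
    by code_simp
  then show "x \<in> fst ` set (hintsA22 @ hintsB22)" if "x \<noteq> Co B0" for x
    using that mem_elements[OF set_as22, of x] by (auto simp: list_all_iff List.member_iff)
  show "list_all (drop_ok r22 as22 (Co B0)) drops22" by (rule drops22_ok)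
  show "length drops22 = 4" by (simp add: drops22_def)
  show "distinct (map (\<lambda>d. pq r22 (Co B0) (At (fst d))) drops22 @ map (\<lambda>d. pq r22 (Co B0) (Co (fst d))) drops22)"
    by code_simp
qed simp

lemma not_nOA_r22: "\<not> nOA (graph_ol r22) 5"
proof (rule graph.not_nOA_graph_ol[OF graph_r22, where a = "\<lambda>i. [Bot, At B8, At B14, Co B0, At B10, At B12] ! i"])
  \<comment> \<open>The inner members are entered in chain order: level 4 puts \<open>B1\<close>
    below the value of \<open>B8\<close>, \<open>B12\<close>, and level 5 below that of
    \<open>B8\<close>, \<open>B14\<close>, which becomes the join of \<open>B1\<close> and
    \<open>B2\<close>, that is \<open>Top\<close>. The entry at index 0 is padding.\<close>
  let ?a = "\<lambda>i. [Bot, At B8, At B14, Co B0, At B10, At B12] ! i"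
  show "\<not> lte r22 (inf_el r22 (imp r22 (?a 1) (?a 3)) (oeqv (graph_ol r22) ?a 5 (?a 1) (?a 2)))
      (imp r22 (?a 2) (?a 3))"
    by code_simp
qed

section \<open>Separating 5OA from 6OA: 26 atoms\<close>

text \<open>The same construction with the longer chain \<open>C10, C12, C14, C16, C18\<close> at \<open>c = C0'\<close>.\<close>

datatype atom26 = C0 | C1 | C2 | C3 | C4 | C5 | C6 | C7 | C8 | C9 | C10 | C11 | C12 | C13 | C14 | C15 | C16 | C17 | C18 | C19 | C20 | C21 | C22 | C23 | C24 | C25

text \<open>Sixteen blocks: 0-2-20, 0-3-21, 0-4-22, 0-5-23, 1-6-9, 1-7-24, 1-8-25, 2-10-11, 2-18-19,
  3-12-13, 4-14-15, 5-16-17, 6-10-13, 7-12-15, 8-14-17, 9-16-19. Here the atoms \<open>C6\<close>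
  and \<open>C9\<close> belonging to the two ends of the chain share a block with
  \<open>C1\<close>.\<close>

primrec r26 :: "atom26 \<Rightarrow> atom26 \<Rightarrow> atom26 rl" where
  "r26 C0 = case_atom26 S F (N C20) (N C21) (N C22) (N C23) F F F F (D C2) (D C2) (D C3) (D C3) (D C4)
     (D C4) (D C5) (D C5) (D C2) (D C2) (N C2) (N C3) (N C4) (N C5) F F"
| "r26 C1 = case_atom26 F S F F F F (N C9) (N C24) (N C25) (N C6) (D C6) F (D C7) (D C6) (D C8) (D C7)
     (D C9) (D C8) F (D C9) F F F F (N C7) (N C8)"
| "r26 C2 = case_atom26 (N C20) F S (D C0) (D C0) (D C0) (D C10) F F (D C19) (N C11) (N C10) F (D C10)
     F F (D C19) F (N C19) (N C18) (N C0) (D C0) (D C0) (D C0) F F"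
| "r26 C3 = case_atom26 (N C21) F (D C0) S (D C0) (D C0) (D C13) (D C12) F F (D C13) F (N C13) (N C12)
     F (D C12) F F F F (D C0) (N C0) (D C0) (D C0) F F"
| "r26 C4 = case_atom26 (N C22) F (D C0) (D C0) S (D C0) F (D C15) (D C14) F F F (D C15) F (N C15)
     (N C14) F (D C14) F F (D C0) (D C0) (N C0) (D C0) F F"
| "r26 C5 = case_atom26 (N C23) F (D C0) (D C0) (D C0) S F F (D C17) (D C16) F F F F (D C17) F (N C17)
     (N C16) F (D C16) (D C0) (D C0) (D C0) (N C0) F F"
| "r26 C6 = case_atom26 F (N C9) (D C10) (D C13) F F S (D C1) (D C1) (N C1) (N C13) (D C10) (D C13)
     (N C10) F F (D C9) F F (D C9) F F F F (D C1) (D C1)"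
| "r26 C7 = case_atom26 F (N C24) F (D C12) (D C15) F (D C1) S (D C1) (D C1) F F (N C15) (D C12)
     (D C15) (N C12) F F F F F F F F (N C1) (D C1)"
| "r26 C8 = case_atom26 F (N C25) F F (D C14) (D C17) (D C1) (D C1) S (D C1) F F F F (N C17) (D C14)
     (D C17) (N C14) F F F F F F (D C1) (N C1)"
| "r26 C9 = case_atom26 F (N C6) (D C19) F F (D C16) (N C1) (D C1) (D C1) S (D C6) F F (D C6) F F
     (N C19) (D C16) (D C19) (N C16) F F F F (D C1) (D C1)"
| "r26 C10 = case_atom26 (D C2) (D C6) (N C11) (D C13) F F (N C13) F F (D C6) S (N C2) (D C13) (N C6)
     F F F F (D C2) (D C2) (D C2) F F F F F"
| "r26 C11 = case_atom26 (D C2) F (N C10) F F F (D C10) F F F (N C2) S F (D C10) F F F F (D C2) (D C2)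
     (D C2) F F F F F"
| "r26 C12 = case_atom26 (D C3) (D C7) F (N C13) (D C15) F (D C13) (N C15) F F (D C13) F S (N C3)
     (D C15) (N C7) F F F F F (D C3) F F (D C7) F"
| "r26 C13 = case_atom26 (D C3) (D C6) (D C10) (N C12) F F (N C10) (D C12) F (D C6) (N C6) (D C10)
     (N C3) S F (D C12) F F F F F (D C3) F F F F"
| "r26 C14 = case_atom26 (D C4) (D C8) F F (N C15) (D C17) F (D C15) (N C17) F F F (D C15) F S (N C4)
     (D C17) (N C8) F F F F (D C4) F F (D C8)"
| "r26 C15 = case_atom26 (D C4) (D C7) F (D C12) (N C14) F F (N C12) (D C14) F F F (N C7) (D C12)
     (N C4) S F (D C14) F F F F (D C4) F (D C7) F"
| "r26 C16 = case_atom26 (D C5) (D C9) (D C19) F F (N C17) (D C9) F (D C17) (N C19) F F F F (D C17) F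
     S (N C5) (D C19) (N C9) F F F (D C5) F F"
| "r26 C17 = case_atom26 (D C5) (D C8) F F (D C14) (N C16) F F (N C14) (D C16) F F F F (N C8) (D C14)
     (N C5) S F (D C16) F F F (D C5) F (D C8)"
| "r26 C18 = case_atom26 (D C2) F (N C19) F F F F F F (D C19) (D C2) (D C2) F F F F (D C19) F S (N C2)
     (D C2) F F F F F"
| "r26 C19 = case_atom26 (D C2) (D C9) (N C18) F F (D C16) (D C9) F F (N C16) (D C2) (D C2) F F F F
     (N C9) (D C16) (N C2) S (D C2) F F F F F"
| "r26 C20 = case_atom26 (N C2) F (N C0) (D C0) (D C0) (D C0) F F F F (D C2) (D C2) F F F F F F (D C2)
     (D C2) S (D C0) (D C0) (D C0) F F"
| "r26 C21 = case_atom26 (N C3) F (D C0) (N C0) (D C0) (D C0) F F F F F F (D C3) (D C3) F F F F F F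
     (D C0) S (D C0) (D C0) F F"
| "r26 C22 = case_atom26 (N C4) F (D C0) (D C0) (N C0) (D C0) F F F F F F F F (D C4) (D C4) F F F F
     (D C0) (D C0) S (D C0) F F"
| "r26 C23 = case_atom26 (N C5) F (D C0) (D C0) (D C0) (N C0) F F F F F F F F F F (D C5) (D C5) F F
     (D C0) (D C0) (D C0) S F F"
| "r26 C24 = case_atom26 F (N C7) F F F F (D C1) (N C1) (D C1) (D C1) F F (D C7) F F (D C7) F F F F F
     F F F S (D C1)"
| "r26 C25 = case_atom26 F (N C8) F F F F (D C1) (D C1) (N C1) (D C1) F F F F (D C8) F F (D C8) F F F
     F F F (D C1) S"

definition as26 :: "atom26 list" where
  "as26 = [C0, C1, C2, C3, C4, C5, C6, C7, C8, C9, C10, C11, C12, C13, C14, C15, C16, C17, C18, C19, C20, C21, C22, C23, C24, C25]"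

lemma set_as26: "set as26 = UNIV"
proof -
  have "a \<in> set as26" for a by (cases a) (simp_all add: as26_def)
  then show ?thesis by blast
qed

lemma graph_r26: "graph r26"
proof (rule graph_if_valid[OF set_as26])
  show "graph_valid r26 as26" by code_simp
qed

definition hintsA26 :: "(atom26 el \<times> atom26 hint) list" where
  "hintsA26 = [
    (Bot, []), (Top, []), (At C0, []), (At C1, [(At C13, Co C16, At C2)]), (At C2, []),
    (At C3, [(At C10, Co C15, At C1)]), (At C4, [(At C12, Co C17, At C1)]),
    (At C5, [(At C14, Co C19, At C1)]),
    (At C6, [(At C11, Co C12, At C0), (At C19, Co C25, At C17)]),
    (At C7, [(At C13, Co C14, At C0)]), (At C8, [(At C15, Co C16, At C0)]),
    (At C9, [(At C10, Co C24, At C12), (At C17, Co C18, At C0)]),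
    (At C10, [(At C3, Co C9, At C7)]), (At C11, [(At C6, Co C20, At C3), (At C13, Co C18, At C9)]),
    (At C12, [(At C4, Co C24, At C8), (At C6, Co C21, At C2)]),
    (At C13, [(At C1, Co C11, At C19), (At C7, Co C21, At C4)]),
    (At C14, [(At C5, Co C25, At C9), (At C7, Co C22, At C3)]),
    (At C15, [(At C3, Co C24, At C6), (At C8, Co C22, At C5)]),
    (At C16, [(At C1, Co C18, At C10), (At C8, Co C23, At C4)]),
    (At C17, [(At C4, Co C25, At C7), (At C9, Co C23, At C2)]),
    (At C18, [(At C9, Co C20, At C5), (At C11, Co C16, At C6)]), (At C19, [(At C5, Co C6, At C8)]),
    (At C20, [(At C11, Co C21, At C13), (At C18, Co C23, At C16)]),
    (At C21, [(At C12, Co C20, At C10), (At C13, Co C22, At C15)]),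
    (At C22, [(At C14, Co C21, At C12), (At C15, Co C23, At C17)]),
    (At C23, [(At C16, Co C22, At C14), (At C17, Co C20, At C19)])]"

definition hintsB26 :: "(atom26 el \<times> atom26 hint) list" where
  "hintsB26 = [
    (At C24, [(At C9, Co C15, At C13), (At C12, Co C25, At C14)]),
    (At C25, [(At C6, Co C14, At C16), (At C17, Co C24, At C15)]),
    (Co C1, [(At C10, At C14, At C0), (At C10, At C16, At C0), (At C10, At C18, Co C20), (At C11, At C15, At C0), (At C11, At C17, At C0), (At C11, At C19, Co C20), (At C11, Co C18, At C0), (At C12, At C16, At C0), (At C12, At C18, At C0), (At C14, At C18, At C0)]),
    (Co C2, [(At C3, At C16, At C7), (At C5, At C13, At C8)]),
    (Co C3, [(At C1, Co C11, At C19), (At C4, Co C24, At C8)]),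
    (Co C4, [(At C3, Co C24, At C6), (At C5, Co C25, At C9)]),
    (Co C5, [(At C1, Co C18, At C10), (At C4, Co C25, At C7)]),
    (Co C6, [(At C7, Co C21, At C4), (At C17, Co C18, At C0)]),
    (Co C7, [(At C3, At C16, At C2), (At C6, Co C21, At C2), (At C8, Co C22, At C5), (At C16, Co C21, At C2)]),
    (Co C8, [(At C5, At C13, At C2), (At C6, At C23, At C2), (At C7, Co C22, At C3), (At C13, Co C23, At C2)]),
    (Co C9, [(At C8, Co C23, At C4), (At C11, Co C12, At C0)]),
    (Co C10, [(At C7, Co C21, At C4), (At C18, At C25, At C17)]),
    (Co C11, [(At C3, Co C9, At C7)]), (Co C12, [(At C1, Co C11, At C19), (At C8, Co C22, At C5)]),
    (Co C13, [(At C4, Co C24, At C8), (At C19, Co C25, At C17)]),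
    (Co C14, [(At C3, Co C24, At C6), (At C9, Co C23, At C2)]),
    (Co C15, [(At C5, Co C25, At C9), (At C6, Co C21, At C2)]),
    (Co C16, [(At C4, Co C25, At C7), (At C10, Co C24, At C12)]),
    (Co C17, [(At C1, Co C18, At C10), (At C7, Co C22, At C3)]), (Co C18, [(At C5, Co C6, At C8)]),
    (Co C19, [(At C8, Co C23, At C4), (At C10, Co C24, At C12)]), (Co C20, []),
    (Co C21, [(At C10, Co C15, At C1)]), (Co C22, [(At C12, Co C17, At C1)]),
    (Co C23, [(At C14, Co C19, At C1)]),
    (Co C24, [(At C13, Co C14, At C0), (At C13, Co C16, At C2)]),
    (Co C25, [(At C13, Co C16, At C2), (At C15, Co C16, At C0)])]"

text \<open>In each run of consecutive members that is left, transitivity forces the bound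
  \<open>C1\<close> for any two that are not adjacent.\<close>

definition drops26 :: "(atom26 \<times> atom26 hint) list" where
  "drops26 = [
    (C10, [(At C12, At C16, At C1), (At C12, At C18, At C1), (At C14, At C18, At C1)]),
    (C12, [(At C14, At C18, At C1)]), (C14, []), (C16, [(At C10, At C14, At C1)]),
    (C18, [(At C10, At C14, At C1), (At C10, At C16, At C1), (At C12, At C16, At C1)])]"

lemma hintsA26_ok: "list_all (full_ok r26 as26) hintsA26"
  by code_simp

lemma hintsB26_ok: "list_all (full_ok r26 as26) hintsB26"
  by code_simp

lemma drops26_ok: "list_all (drop_ok r26 as26 (Co C0)) drops26"
  by code_simp

lemma nOA_r26: "nOA (graph_ol r26) 5"
proof (rule graph.nOA_if_certificate[OF graph_r26 set_as26])
  show "list_all (full_ok r26 as26) (hintsA26 @ hintsB26)"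
    by (simp add: hintsA26_ok hintsB26_ok)
  have "list_all (\<lambda>x. x = Co C0 \<or> List.member (map fst (hintsA26 @ hintsB26)) x) (elements as26)"
    by code_simp
  then show "x \<in> fst ` set (hintsA26 @ hintsB26)" if "x \<noteq> Co C0" for x
    using that mem_elements[OF set_as26, of x] by (auto simp: list_all_iff List.member_iff)
  show "list_all (drop_ok r26 as26 (Co C0)) drops26" by (rule drops26_ok)
  show "length drops26 = 5" by (simp add: drops26_def)
  show "distinct (map (\<lambda>d. pq r26 (Co C0) (At (fst d))) drops26 @ map (\<lambda>d. pq r26 (Co C0) (Co (fst d))) drops26)"
    by code_simp
qed simp

lemma not_nOA_r26: "\<not> nOA (graph_ol r26) 6"
proof (rule graph.not_nOA_graph_ol[OF graph_r26, where a = "\<lambda>i. [Bot, At C10, At C18, Co C0, At C12, At C14, At C16] ! i"])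
  let ?a = "\<lambda>i. [Bot, At C10, At C18, Co C0, At C12, At C14, At C16] ! i"
  show "\<not> lte r26 (inf_el r26 (imp r26 (?a 1) (?a 3)) (oeqv (graph_ol r26) ?a 6 (?a 1) (?a 2)))
      (imp r26 (?a 2) (?a 3))"
    by code_simp
qed

theorem theorem4p5:
  shows "(\<forall>(L :: 'a ol) n. ortholattice L \<and> n > 3 \<and> nOA L n \<longrightarrow> nOA L (n - 1))
       \<and> (\<forall>n \<in> {3, 4, 5 :: nat}. \<exists>L :: nat ol.
            ortholattice L \<and> orthomodular L \<and> finite (carrier L)
            \<and> nOA L n \<and> \<not> nOA L (n + 1))"
proof (intro conjI)
  show "\<forall>(L :: 'a ol) n. ortholattice L \<and> n > 3 \<and> nOA L n \<longrightarrow> nOA L (n - 1)"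
    using ortholat.nOA_pred[OF ortholat.intro] by blast
next
  have "\<exists>L :: nat ol. ortholattice L \<and> orthomodular L \<and> finite (carrier L) \<and> nOA L 3 \<and> \<not> nOA L (3 + 1)"
    by (rule graph.separating_ol_in_nat[OF graph_r17 set_as17 _ nOA_r17]) (use not_nOA_r17 in simp_all)
  moreover have "\<exists>L :: nat ol. ortholattice L \<and> orthomodular L \<and> finite (carrier L) \<and> nOA L 4 \<and> \<not> nOA L (4 + 1)"
    by (rule graph.separating_ol_in_nat[OF graph_r22 set_as22 _ nOA_r22]) (use not_nOA_r22 in simp_all)
  moreover have "\<exists>L :: nat ol. ortholattice L \<and> orthomodular L \<and> finite (carrier L) \<and> nOA L 5 \<and> \<not> nOA L (5 + 1)"
    by (rule graph.separating_ol_in_nat[OF graph_r26 set_as26 _ nOA_r26]) (use not_nOA_r26 in simp_all)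
  ultimately show "\<forall>n \<in> {3, 4, 5 :: nat}. \<exists>L :: nat ol. ortholattice L \<and> orthomodular L \<and> finite (carrier L)
      \<and> nOA L n \<and> \<not> nOA L (n + 1)"
    by blast
qed

end
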